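(* Let $\mathcal{B}$ be a unital AF C*-algebra with canonical masa $\mathcal{D}$ and let $\mathcal{A}$ be a canonical subalgebra of $\mathcal{B}$, i.e., a norm-closed subalgebra such that $\mathcal{D} \subseteq \mathcal{A} \subseteq \mathcal{B}$. A norm-closed linear subspace $\mathcal{L}$ of $\mathcal{B}$ is a Lie subspace over $\mathcal{A}$ if, and only if, it is invariant under similarities from $\mathcal{A}$, i.e., $a^{-1}xa \in \mathcal{L}$ for every $x \in \mathcal{L}$ and every invertible element $a$ of $\mathcal{A}$.
   Context: A linear subspace $\mathcal{L} \subseteq \mathcal{B}$ is a Lie subspace over $\mathcal{A}$ if $ax - xa \in \mathcal{L}$ for every $x \in \mathcal{L}$ and $a \in \mathcal{A}$. An invertible element of $\mathcal{A}$ is an element of $\mathcal{A}$ having its inverse in $\mathcal{A}$. Canonical masa: there is an increasing sequence $(\mathcal{B}_n)$ of finite dimensional C*-subalgebras of $\mathcal{B}$, each containing the unit of $\mathcal{B}$, with $\overline{\bigcup_n \mathcal{B}_n} = \mathcal{B}$, and for each $n$ a system of matrix units $\{e^n_{ij}\}$ for $\mathcal{B}_n$, such that each matrix unit of $\mathcal{B}_n$ is a sum of matrix units of $\mathcal{B}_{n+1}$; $\mathcal{D}_n$ is the maximal abelian self-adjoint subalgebra of $\mathcal{B}_n$ spanned by the diagonal matrix units (so $\mathcal{D}_n \subseteq \mathcal{D}_{n+1}$), and $\mathcal{D} = \overline{\bigcup_n \mathcal{D}_n}$. *)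

theory Defs
  imports "HOL-Analysis.Analysis"
begin

text \<open>
  Unital complex C*-algebras. The superclass \<^class>\<open>real_normed_algebra_1\<close> supplies the unit, the
  submultiplicative norm and \<open>norm 1 = 1\<close>; in particular the zero algebra is excluded.
\<close>

class cstar_algebra = real_normed_algebra_1 + banach +
  fixes scaleC :: "complex \<Rightarrow> 'a \<Rightarrow> 'a" (infixr "*\<^sub>C" 75)
    and star :: "'a \<Rightarrow> 'a"
  assumes scaleC_add_right: "c *\<^sub>C (x + y) = c *\<^sub>C x + c *\<^sub>C y"
    and scaleC_add_left: "(c + d) *\<^sub>C x = c *\<^sub>C x + d *\<^sub>C x"
    and scaleC_scaleC: "c *\<^sub>C (d *\<^sub>C x) = (c * d) *\<^sub>C x"
    and scaleC_one: "1 *\<^sub>C x = x"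
    and scaleR_scaleC: "scaleR r x = complex_of_real r *\<^sub>C x"
    and mult_scaleC_left: "(c *\<^sub>C x) * y = c *\<^sub>C (x * y)"
    and mult_scaleC_right: "x * (c *\<^sub>C y) = c *\<^sub>C (x * y)"
    and norm_scaleC: "norm (c *\<^sub>C x) = cmod c * norm x"
    and star_add: "star (x + y) = star x + star y"
    and star_scaleC: "star (c *\<^sub>C x) = cnj c *\<^sub>C star x"
    and star_mult: "star (x * y) = star y * star x"
    and star_star: "star (star x) = x"
    and cstar_identity: "norm (star x * x) = (norm x)\<^sup>2"

instantiation complex :: cstar_algebra
begin

definition scaleC_complex :: "complex \<Rightarrow> complex \<Rightarrow> complex" where
  "scaleC_complex = (*)"

definition star_complex :: "complex \<Rightarrow> complex" where
  "star_complex = cnj"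

instance
  by standard
    (simp_all add: scaleC_complex_def star_complex_def algebra_simps scaleR_conv_of_real
      norm_mult power2_eq_square)

end

global_interpretation complex_vector:
  vector_space "scaleC :: complex \<Rightarrow> 'a \<Rightarrow> 'a::cstar_algebra"
  by unfold_locales (simp_all add: scaleC_add_right scaleC_add_left scaleC_scaleC scaleC_one)

definition subalgebra :: "'a::cstar_algebra set \<Rightarrow> bool" where
  "subalgebra S \<longleftrightarrow> complex_vector.subspace S \<and> (\<forall>x\<in>S. \<forall>y\<in>S. x * y \<in> S)"

definition cstar_subalgebra :: "'a::cstar_algebra set \<Rightarrow> bool" where
  "cstar_subalgebra S \<longleftrightarrow> subalgebra S \<and> (\<forall>x\<in>S. star x \<in> S) \<and> closed S"

definition finite_dimensional :: "'a::cstar_algebra set \<Rightarrow> bool" where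
  "finite_dimensional S \<longleftrightarrow> (\<exists>F. finite F \<and> S = complex_vector.span F)"

text \<open>
  A finite-dimensional C*-algebra is a direct sum of \<open>r\<close> full matrix algebras, the \<open>k\<close>-th one of
  size \<open>d k\<close>. Its matrix units are indexed by triples \<open>(k, i, j)\<close>: block, row and column.
\<close>

definition matrix_unit_index :: "nat \<Rightarrow> (nat \<Rightarrow> nat) \<Rightarrow> (nat \<times> nat \<times> nat) set" where
  "matrix_unit_index r d = {(k, i, j). k < r \<and> i < d k \<and> j < d k}"

definition matrix_units ::
  "'a::cstar_algebra set \<Rightarrow> nat \<Rightarrow> (nat \<Rightarrow> nat) \<Rightarrow> (nat \<times> nat \<times> nat \<Rightarrow> 'a) \<Rightarrow> bool" where
  "matrix_units S r d e \<longleftrightarrow>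
     (\<forall>u\<in>matrix_unit_index r d. e u \<noteq> 0) \<and>
     (\<forall>(k, i, j)\<in>matrix_unit_index r d. star (e (k, i, j)) = e (k, j, i)) \<and>
     (\<forall>(k, i, j)\<in>matrix_unit_index r d. \<forall>(l, p, q)\<in>matrix_unit_index r d.
        e (k, i, j) * e (l, p, q) = (if k = l \<and> j = p then e (k, i, q) else 0)) \<and>
     complex_vector.span (e ` matrix_unit_index r d) = S"

definition diagonal_span ::
  "nat \<Rightarrow> (nat \<Rightarrow> nat) \<Rightarrow> (nat \<times> nat \<times> nat \<Rightarrow> 'a::cstar_algebra) \<Rightarrow> 'a set" where
  "diagonal_span r d e = complex_vector.span {e (k, i, i) | k i. k < r \<and> i < d k}"

text \<open>The ambient algebra, here the whole type, is AF if it admits such a sequence \<open>B\<close>.\<close>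

definition AF_sequence :: "(nat \<Rightarrow> 'a::cstar_algebra set) \<Rightarrow> bool" where
  "AF_sequence B \<longleftrightarrow>
     (\<forall>n. cstar_subalgebra (B n) \<and> finite_dimensional (B n) \<and> 1 \<in> B n) \<and>
     incseq B \<and> closure (\<Union>n. B n) = UNIV"

definition canonical_masa :: "'a::cstar_algebra set \<Rightarrow> bool" where
  "canonical_masa D \<longleftrightarrow>
     (\<exists>B r d e.
        AF_sequence B \<and>
        (\<forall>n. matrix_units (B n) (r n) (d n) (e n)) \<and>
        (\<forall>n. \<forall>u\<in>matrix_unit_index (r n) (d n).
           \<exists>T\<subseteq>matrix_unit_index (r (Suc n)) (d (Suc n)). e n u = (\<Sum>v\<in>T. e (Suc n) v)) \<and>
        D = closure (\<Union>n. diagonal_span (r n) (d n) (e n)))"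

definition canonical_subalgebra :: "'a::cstar_algebra set \<Rightarrow> 'a set \<Rightarrow> bool" where
  "canonical_subalgebra D A \<longleftrightarrow> subalgebra A \<and> closed A \<and> D \<subseteq> A"

definition lie_subspace_over :: "'a::cstar_algebra set \<Rightarrow> 'a set \<Rightarrow> bool" where
  "lie_subspace_over A L \<longleftrightarrow>
     complex_vector.subspace L \<and> (\<forall>x\<in>L. \<forall>a\<in>A. a * x - x * a \<in> L)"

text \<open>Here \<open>b\<close> is the (unique) inverse of \<open>a\<close>, which is required to lie in \<open>A\<close>.\<close>

definition similarity_invariant :: "'a::cstar_algebra set \<Rightarrow> 'a set \<Rightarrow> bool" where
  "similarity_invariant A L \<longleftrightarrow>
     (\<forall>x\<in>L. \<forall>a\<in>A. \<forall>b\<in>A. a * b = 1 \<and> b * a = 1 \<longrightarrow> b * x * a \<in> L)"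

end

theory Submission
  imports Defs
begin

text \<open>
  That similarity invariance gives the Lie property is a matter of differentiating
  \<open>exp (t a) * x * exp (- t a)\<close> at \<open>t = 0\<close>.

  For the converse, let \<open>L\<close> be a closed Lie subspace over \<open>A\<close>. Along a Lipschitz path \<open>g\<close> of
  invertible elements of \<open>A\<close> with \<open>g 0 = 1\<close>, the curve \<open>y t = g(t)\<^sup>-\<^sup>1 * x * g(t)\<close> solves the
  linear equation \<open>y' = y * k - k * y\<close> with coefficient \<open>k = g\<^sup>-\<^sup>1 * g'\<close> in \<open>A\<close>, whose Euler
  polygons stay in \<open>L\<close> when they start in \<open>L\<close>; hence so does the curve itself
  (\<open>lie_similarity_along_path\<close>). It therefore suffices to join sufficiently many invertible
  elements of \<open>A\<close> to \<open>1\<close> inside the invertible group of \<open>A\<close>, even though that group may be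
  disconnected.

  An element \<open>a\<close> of a finite-dimensional subalgebra is annihilated by a nonzero polynomial, so
  \<open>a - z\<close> is invertible in the unital algebra generated by \<open>a\<close> for all but finitely many \<open>z\<close>. After
  an arbitrarily small imaginary shift the horizontal half-line from \<open>0\<close> to \<open>-\<infinity>\<close> avoids these
  exceptional \<open>z\<close>, and the segment from \<open>1\<close> to the shifted element consists of invertibles
  (\<open>lie_similarity_finite_dimensional\<close>).

  What remains is to approximate each element of \<open>A\<close> by elements of \<open>A \<inter> B N\<close>
  (\<open>closed_subalgebra_inductive\<close>). Two facts enter. A matrix unit lies in \<open>A\<close> as soon as some
  nonzero scalar multiple \<open>c\<close> of it is within distance less than \<open>\<bar>c\<bar>\<close> of \<open>A\<close>
  (\<open>unit_in_bimodule\<close>), because \<open>A\<close> is a module over the diagonal. So, for an approximant in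
  \<open>B N\<close> with error \<open>\<delta>\<close>, only coefficients of size at most \<open>\<delta>\<close> have to be discarded. Discarding
  many small coefficients may be costly in norm, but a contractive pinching onto the
  span of the pieces into which the matrix units of a fixed lower level \<open>B n\<close> decompose fixes
  \<open>B n\<close>, and in that span the discarded part is a sum of \<open>card (idx n)\<close> many orthogonal sums, each
  of norm at most \<open>\<delta>\<close>. As \<open>n\<close> is chosen before \<open>\<delta>\<close>, the total loss is small.
\<close>

section \<open>Norms of projections and of orthogonal sums\<close>

lemma star_zero [simp]: "star (0::'a::cstar_algebra) = 0"
  using star_add[of 0 "0::'a"] by simp

lemma star_sum: "star (\<Sum>i\<in>I. f i) = (\<Sum>i\<in>I. star (f i :: 'a::cstar_algebra))"
  by (induction I rule: infinite_finite_induct) (simp_all add: star_add)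

lemma norm_star: "norm (star x) = norm (x::'a::cstar_algebra)"
proof -
  have le: "norm y \<le> norm (star y)" for y :: 'a
  proof (cases "y = 0")
    case False
    have "norm y * norm y \<le> norm (star y) * norm y"
      using norm_mult_ineq[of "star y" y] by (simp add: cstar_identity power2_eq_square)
    then show ?thesis using False by simp
  qed simp
  show ?thesis using le[of x] le[of "star x"] by (simp add: star_star)
qed

lemma norm_projection:
  fixes p :: "'a::cstar_algebra"
  assumes "star p = p" "p * p = p" "p \<noteq> 0"
  shows "norm p = 1"
  using cstar_identity[of p] assms by (simp add: power2_eq_square)

lemma norm_selfadjoint_power:
  fixes h :: "'a::cstar_algebra"
  assumes "star h = h"
  shows "norm (h ^ 2 ^ k) = norm h ^ 2 ^ k"
proof (induction k)
  case (Suc k)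
  have sp: "star (h ^ m) = h ^ m" if "m > 0" for m
    using that
  proof (induction m)
    case (Suc m)
    then show ?case using assms by (cases "m = 0") (simp_all add: star_mult power_commutes)
  qed simp
  have "norm (h ^ 2 ^ Suc k) = norm (star (h ^ 2 ^ k) * h ^ 2 ^ k)"
    by (simp add: sp mult_2 power_add)
  also have "\<dots> = norm h ^ 2 ^ Suc k"
    by (simp add: cstar_identity Suc power_mult[symmetric] mult.commute)
  finally show ?case .
qed simp

text \<open>
  The elements \<open>star (a i) * a i\<close> are mutually annihilating, so a power of their sum is the sum of
  their powers. The C*-identity turns this into \<open>\<parallel>\<Sum>a i\<parallel>\<^bsup>2m\<^esup> \<le> card I * M\<^bsup>2m\<^esup>\<close> for every power
  \<open>m\<close> of two, and the factor \<open>card I\<close> disappears on taking roots.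
\<close>
lemma norm_orthogonal_sum_le:
  fixes a :: "'i \<Rightarrow> 'a::cstar_algebra"
  assumes fin: "finite I" and M: "0 \<le> M" "\<And>i. i \<in> I \<Longrightarrow> norm (a i) \<le> M"
    and orth: "\<And>i j. i \<in> I \<Longrightarrow> j \<in> I \<Longrightarrow> i \<noteq> j \<Longrightarrow> star (a i) * a j = 0"
      "\<And>i j. i \<in> I \<Longrightarrow> j \<in> I \<Longrightarrow> i \<noteq> j \<Longrightarrow> a i * star (a j) = 0"
  shows "norm (\<Sum>i\<in>I. a i) \<le> M"
proof (rule ccontr)
  let ?S = "\<Sum>i\<in>I. a i" and ?h = "\<lambda>i. star (a i) * a i"
  assume "\<not> norm ?S \<le> M"
  then have gt: "M < norm ?S" by simp
  have sq: "star ?S * ?S = (\<Sum>i\<in>I. ?h i)"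
  proof -
    have "star ?S * ?S = (\<Sum>i\<in>I. \<Sum>j\<in>I. star (a i) * a j)"
      by (simp add: star_sum sum_product)
    also have "\<dots> = (\<Sum>i\<in>I. \<Sum>j\<in>I. if j = i then ?h i else 0)"
      using orth by (intro sum.cong) auto
    finally show ?thesis using fin by simp
  qed
  have pow: "(\<Sum>i\<in>I. ?h i) ^ Suc m = (\<Sum>i\<in>I. ?h i ^ Suc m)" for m
  proof (induction m)
    case (Suc m)
    have "(\<Sum>i\<in>I. ?h i) ^ Suc (Suc m) = (\<Sum>i\<in>I. \<Sum>j\<in>I. ?h i * ?h j ^ Suc m)"
      by (subst power_Suc, subst Suc) (simp add: sum_product)
    also have "\<dots> = (\<Sum>i\<in>I. \<Sum>j\<in>I. if j = i then ?h i ^ Suc (Suc m) else 0)"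
    proof (intro sum.cong refl)
      fix i j assume ij: "i \<in> I" "j \<in> I"
      have "?h i * ?h j = 0" if "i \<noteq> j"
      proof -
        have "?h i * ?h j = star (a i) * (a i * star (a j)) * a j" by (simp add: mult.assoc)
        then show ?thesis using orth(2)[OF ij that] by simp
      qed
      then have "?h i * ?h j ^ Suc m = 0" if "i \<noteq> j"
        using that by (simp flip: mult.assoc)
      then show "?h i * ?h j ^ Suc m = (if j = i then ?h i ^ Suc (Suc m) else 0)" by auto
    qed
    finally show ?case using fin by simp
  qed simp
  have bound: "(norm ?S)\<^sup>2 ^ 2 ^ k \<le> card I * (M\<^sup>2) ^ 2 ^ k" for k
  proof -
    obtain m where m: "(2::nat) ^ k = Suc m" by (metis not0_implies_Suc power_not_zero zero_neq_numeral)
    have sa: "star (star ?S * ?S) = star ?S * ?S" by (simp add: star_mult star_star)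
    have "(norm ?S)\<^sup>2 ^ 2 ^ k = norm (star ?S * ?S) ^ 2 ^ k" by (simp add: cstar_identity)
    also have "\<dots> = norm ((star ?S * ?S) ^ 2 ^ k)"
      using norm_selfadjoint_power[OF sa] by simp
    also have "\<dots> = norm (\<Sum>i\<in>I. ?h i ^ 2 ^ k)" unfolding sq m pow by simp
    also have "\<dots> \<le> (\<Sum>i\<in>I. (M\<^sup>2) ^ 2 ^ k)"
    proof (rule sum_norm_le)
      fix i assume i: "i \<in> I"
      have "norm (?h i ^ 2 ^ k) \<le> norm (?h i) ^ 2 ^ k" by (rule norm_power_ineq)
      also have "\<dots> \<le> (M\<^sup>2) ^ 2 ^ k"
        using M(2)[OF i] by (simp add: cstar_identity power_mono)
      finally show "norm (?h i ^ 2 ^ k) \<le> (M\<^sup>2) ^ 2 ^ k" .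
    qed
    finally show ?thesis by simp
  qed
  show False
  proof (cases "M = 0")
    case True
    then show False using bound[of 0] gt by simp
  next
    case False
    then have M0: "M > 0" using M(1) by simp
    define \<rho> where "\<rho> = (norm ?S)\<^sup>2 / M\<^sup>2"
    have "\<rho> > 1" using M0 gt unfolding \<rho>_def by (simp add: power_strict_mono)
    then obtain n where n: "real (card I) < \<rho> ^ n" using real_arch_pow by blast
    have "\<rho> ^ n \<le> \<rho> ^ 2 ^ n"
      using \<open>\<rho> > 1\<close> by (intro power_increasing) (auto simp: less_imp_le)
    moreover have "\<rho> ^ 2 ^ n \<le> card I"
      using bound[of n] M0 by (simp add: \<rho>_def power_divide divide_le_eq)
    ultimately show False using n by simp
  qed
qed

lemma norm_mult_le_right: "norm a \<le> 1 \<Longrightarrow> norm (a * b) \<le> norm (b::'a::real_normed_algebra)"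
  using norm_mult_ineq[of a b] mult_right_mono[of "norm a" 1 "norm b"] by simp

lemma norm_mult_le_left: "norm b \<le> 1 \<Longrightarrow> norm (a * b) \<le> norm (a::'a::real_normed_algebra)"
  using norm_mult_ineq[of a b] mult_left_mono[of "norm b" 1 "norm a"] by simp

section \<open>Subspaces and subalgebras\<close>

lemma subalgebraD:
  assumes "subalgebra S"
  shows "complex_vector.subspace S" "x \<in> S \<Longrightarrow> y \<in> S \<Longrightarrow> x * y \<in> S"
  using assms by (auto simp: subalgebra_def)

lemma subspace_scaleR:
  assumes "complex_vector.subspace S" "x \<in> S"
  shows "t *\<^sub>R x \<in> S"
  using assms by (simp add: scaleR_scaleC complex_vector.subspace_scale)

lemma subalgebra_power:
  assumes "subalgebra S" "1 \<in> S" "x \<in> S"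
  shows "x ^ n \<in> S"
  by (induction n) (use assms in \<open>auto intro: subalgebraD\<close>)

section \<open>Similarity invariance implies the Lie property\<close>

lemma exp_in_closed_subalgebra:
  assumes "subalgebra S" "1 \<in> S" "closed S" "x \<in> S"
  shows "exp x \<in> S"
proof -
  have "(\<lambda>n. \<Sum>k<n. x ^ k /\<^sub>R fact k) \<longlonglongrightarrow> exp x"
    using summable_exp_generic[of x] unfolding exp_def by (rule summable_LIMSEQ)
  moreover have "(\<Sum>k<n. x ^ k /\<^sub>R fact k) \<in> S" for n
    using assms by (intro complex_vector.subspace_sum subspace_scaleR subalgebra_power) (auto dest: subalgebraD)
  ultimately show ?thesis using \<open>closed S\<close> by (meson closed_sequentially)
qed

text \<open>
  The orbit \<open>exp (t a) * x * exp (- t a)\<close> lies in the closed subspace \<open>L\<close>, hence so does its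
  derivative at \<open>0\<close>, which is the commutator \<open>a * x - x * a\<close>.
\<close>
lemma similarity_invariant_imp_lie:
  fixes A L :: "'a::cstar_algebra set"
  assumes A: "subalgebra A" "1 \<in> A" "closed A"
    and L: "complex_vector.subspace L" "closed L" and inv: "similarity_invariant A L"
  shows "lie_subspace_over A L"
proof -
  have "a * x - x * a \<in> L" if x: "x \<in> L" and a: "a \<in> A" for x a
  proof -
    let ?F = "\<lambda>t. exp (t *\<^sub>R a) * (x * exp (t *\<^sub>R (- a)))"
    have FL: "?F t \<in> L" for t
    proof -
      have "exp (t *\<^sub>R a) \<in> A" "exp (t *\<^sub>R (- a)) \<in> A"
        using a A complex_vector.subspace_neg[OF subalgebraD(1)[OF A(1)]]
        by (auto intro!: exp_in_closed_subalgebra subspace_scaleR subalgebraD)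
      moreover have "exp (t *\<^sub>R a) * exp (t *\<^sub>R (- a)) = 1" "exp (t *\<^sub>R (- a)) * exp (t *\<^sub>R a) = 1"
        using exp_minus_inverse[of "t *\<^sub>R a"] exp_minus_inverse[of "- t *\<^sub>R a"] by simp_all
      ultimately show ?thesis
        using inv x unfolding similarity_invariant_def by (metis mult.assoc)
    qed
    have "(?F has_vector_derivative
        (exp (0 *\<^sub>R a) * (x * (exp (0 *\<^sub>R (- a)) * (- a))) + (exp (0 *\<^sub>R a) * a) * (x * exp (0 *\<^sub>R (- a))))) (at 0)"
      by (intro has_vector_derivative_mult has_vector_derivative_mult_right
          exp_scaleR_has_vector_derivative_right)
    then have "(?F has_vector_derivative (a * x - x * a)) (at 0)"
      by simp
    then have lim: "((\<lambda>t. norm (?F (0 + t) - ?F 0 - t *\<^sub>R (a * x - x * a)) / norm t) \<longlongrightarrow> 0) (at 0)"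
      unfolding has_vector_derivative_def has_derivative_at by blast
    have "((\<lambda>t. (?F (0 + t) - ?F 0) /\<^sub>R t - (a * x - x * a)) \<longlongrightarrow> 0) (at 0)"
    proof (rule tendsto_norm_zero_cancel, rule Lim_transform_eventually[OF lim])
      have "norm (v - t *\<^sub>R w) / norm t = norm (v /\<^sub>R t - w)" if "t \<noteq> 0" for v w :: 'a and t :: real
      proof -
        have "v /\<^sub>R t - w = (v - t *\<^sub>R w) /\<^sub>R t" using that by (simp add: scaleR_diff_right)
        then show ?thesis by (simp add: divide_inverse mult.commute)
      qed
      then show "\<forall>\<^sub>F t in at 0. norm (?F (0 + t) - ?F 0 - t *\<^sub>R (a * x - x * a)) / norm t
          = norm ((?F (0 + t) - ?F 0) /\<^sub>R t - (a * x - x * a))"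
        by (auto simp: eventually_at_filter)
    qed
    then have "((\<lambda>t. (?F (0 + t) - ?F 0) /\<^sub>R t) \<longlongrightarrow> a * x - x * a) (at 0)"
      by (simp add: LIM_zero_iff)
    moreover have "(?F (0 + t) - ?F 0) /\<^sub>R t \<in> L" for t
      using FL L(1) by (intro subspace_scaleR complex_vector.subspace_diff)
    ultimately show ?thesis
      by (intro Lim_in_closed_set[OF L(2)]) (auto simp: trivial_limit_at)
  qed
  then show ?thesis using L(1) by (auto simp: lie_subspace_over_def)
qed

section \<open>Towers of matrix units\<close>

locale matrix_unit_tower =
  fixes B :: "nat \<Rightarrow> 'a::cstar_algebra set" and r :: "nat \<Rightarrow> nat" and d :: "nat \<Rightarrow> nat \<Rightarrow> nat"
    and e :: "nat \<Rightarrow> nat \<times> nat \<times> nat \<Rightarrow> 'a"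
  assumes AF: "AF_sequence B"
    and units: "matrix_units (B n) (r n) (d n) (e n)"
    and refine: "u \<in> matrix_unit_index (r n) (d n) \<Longrightarrow>
      \<exists>T\<subseteq>matrix_unit_index (r (Suc n)) (d (Suc n)). e n u = (\<Sum>v\<in>T. e (Suc n) v)"
begin

abbreviation "idx n \<equiv> matrix_unit_index (r n) (d n)"

text \<open>
  Minimal diagonal projections of level \<open>n\<close> are indexed by pairs of a block and a row.
\<close>
definition diag :: "nat \<Rightarrow> (nat \<times> nat) set" where
  "diag n = (SIGMA k:{..<r n}. {..<d n k})"

definition dproj :: "nat \<Rightarrow> nat \<times> nat \<Rightarrow> 'a" where
  "dproj n s = e n (fst s, snd s, snd s)"

lemma finite_diag: "finite (diag n)"
  by (simp add: diag_def)

lemma mem_diag [simp]: "(k, i) \<in> diag n \<longleftrightarrow> k < r n \<and> i < d n k"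
  by (auto simp: diag_def)

lemma mem_idx [simp]: "(k, i, j) \<in> idx n \<longleftrightarrow> k < r n \<and> i < d n k \<and> j < d n k"
  by (simp add: matrix_unit_index_def)

lemma finite_idx: "finite (idx n)"
proof -
  have "idx n \<subseteq> (SIGMA k:{..<r n}. {..<d n k} \<times> {..<d n k})" by (auto simp: matrix_unit_index_def)
  then show ?thesis by (rule finite_subset) simp
qed

lemma unit_mult:
  assumes "k < r n" "i < d n k" "j < d n k" "l < r n" "a < d n l" "b < d n l"
  shows "e n (k, i, j) * e n (l, a, b) = (if k = l \<and> j = a then e n (k, i, b) else 0)"
proof -
  have "(k, i, j) \<in> idx n" "(l, a, b) \<in> idx n" using assms by auto
  then show ?thesis using units[of n] unfolding matrix_units_def by blast
qed

lemma unit_star: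
  assumes "k < r n" "i < d n k" "j < d n k"
  shows "star (e n (k, i, j)) = e n (k, j, i)"
proof -
  have "(k, i, j) \<in> idx n" using assms by auto
  then show ?thesis using units[of n] unfolding matrix_units_def by blast
qed

lemma unit_nonzero: "u \<in> idx n \<Longrightarrow> e n u \<noteq> 0"
  using units[of n] unfolding matrix_units_def by blast

lemma span_units: "complex_vector.span (e n ` idx n) = B n"
  using units[of n] unfolding matrix_units_def by blast

lemma subalgebra_B: "subalgebra (B n)"
  using AF by (auto simp: AF_sequence_def cstar_subalgebra_def)

lemma one_in_B: "1 \<in> B n"
  using AF by (auto simp: AF_sequence_def)

lemma B_mono: "n \<le> N \<Longrightarrow> B n \<subseteq> B N"
  using AF by (auto simp: AF_sequence_def incseq_def)

lemma B_dense:
  assumes "\<epsilon> > 0"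
  shows "\<exists>N\<ge>n. \<exists>y\<in>B N. norm (x - y) < \<epsilon>"
proof -
  have "x \<in> closure (\<Union>m. B m)" using AF by (simp add: AF_sequence_def)
  then obtain y m where "y \<in> B m" "dist y x < \<epsilon>"
    using assms by (auto simp: closure_approachable)
  then have "y \<in> B (max n m)" "norm (x - y) < \<epsilon>"
    using B_mono[of m "max n m"] by (auto simp: dist_norm norm_minus_commute)
  then show ?thesis
    by (intro exI[of _ "max n m"] conjI bexI[of _ y]) simp_all
qed

lemma unit_in_B: "u \<in> idx n \<Longrightarrow> e n u \<in> B n"
  unfolding span_units[symmetric] by (intro complex_vector.span_base imageI)

lemma dproj_mult:
  assumes "s \<in> diag n" "t \<in> diag n"
  shows "dproj n s * dproj n t = (if s = t then dproj n s else 0)"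
  using assms by (cases s; cases t) (auto simp: dproj_def unit_mult)

lemma dproj_star: "s \<in> diag n \<Longrightarrow> star (dproj n s) = dproj n s"
  by (cases s) (auto simp: dproj_def unit_star)

lemma dproj_nonzero: "s \<in> diag n \<Longrightarrow> dproj n s \<noteq> 0"
  by (cases s) (auto simp: dproj_def intro!: unit_nonzero)

lemma norm_dproj: "s \<in> diag n \<Longrightarrow> norm (dproj n s) = 1"
  by (intro norm_projection) (simp_all add: dproj_star dproj_mult dproj_nonzero)

lemma dproj_mult_unit:
  assumes "s \<in> diag n" "(k, i, j) \<in> idx n"
  shows "dproj n s * e n (k, i, j) = (if s = (k, i) then e n (k, i, j) else 0)"
  using assms by (cases s) (auto simp: dproj_def unit_mult)

lemma unit_mult_dproj:
  assumes "s \<in> diag n" "(k, i, j) \<in> idx n"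
  shows "e n (k, i, j) * dproj n s = (if s = (k, j) then e n (k, i, j) else 0)"
  using assms by (cases s) (auto simp: dproj_def unit_mult)

text \<open>
  The sum of the diagonal units acts as a left unit on all matrix units, hence on the span \<open>B n\<close>,
  which contains \<open>1\<close>.
\<close>
lemma sum_dproj: "(\<Sum>s\<in>diag n. dproj n s) = 1"
proof -
  let ?g = "\<Sum>s\<in>diag n. dproj n s"
  have "?g * y = y" if "y \<in> complex_vector.span (e n ` idx n)" for y
    using that
  proof (induction rule: complex_vector.span_induct_alt)
    case (step c x y)
    then obtain k i j where u: "(k, i, j) \<in> idx n" "x = e n (k, i, j)" by auto
    have "?g * x = (\<Sum>s\<in>diag n. if s = (k, i) then x else 0)"
      unfolding sum_distrib_right by (intro sum.cong refl) (use dproj_mult_unit u in auto)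
    also have "\<dots> = x" using u by (simp add: finite_diag)
    finally show ?case using step by (simp add: distrib_left mult_scaleC_right)
  qed simp
  then show ?thesis using one_in_B[of n] by (metis mult.right_neutral span_units)
qed

lemma corner_scalar:
  assumes s: "s \<in> diag n" and y: "y \<in> B n"
  shows "\<exists>c. dproj n s * y * dproj n s = c *\<^sub>C dproj n s"
proof -
  have "y \<in> complex_vector.span (e n ` idx n)" using y by (simp add: span_units)
  then show ?thesis
  proof (induction rule: complex_vector.span_induct_alt)
    case base
    show ?case by (intro exI[of _ 0]) simp
  next
    case (step c x y)
    then obtain k i j where u: "(k, i, j) \<in> idx n" "x = e n (k, i, j)" by auto
    obtain c' where c': "dproj n s * y * dproj n s = c' *\<^sub>C dproj n s" using step by blast
    have "dproj n s * x * dproj n s = (if s = (k, i) \<and> s = (k, j) then 1 else 0) *\<^sub>C dproj n s"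
      using u s by (auto simp: dproj_mult_unit unit_mult_dproj scaleC_one) (simp add: dproj_def)
    moreover have "dproj n s * (c *\<^sub>C x + y) * dproj n s = c *\<^sub>C (dproj n s * x * dproj n s) + dproj n s * y * dproj n s"
      by (simp add: distrib_left distrib_right mult_scaleC_left mult_scaleC_right)
    ultimately have "dproj n s * (c *\<^sub>C x + y) * dproj n s =
        (c * (if s = (k, i) \<and> s = (k, j) then 1 else 0) + c') *\<^sub>C dproj n s"
      by (simp only: c' scaleC_add_left scaleC_scaleC)
    then show ?case by blast
  qed
qed

text \<open>
  A matrix unit of level \<open>n\<close>, written as a sum of matrix units of the next level, uses at most one
  of them in each row: if row \<open>(l, a)\<close> contains a set \<open>J\<close> of them, then compressing
  \<open>e n (k, i, j) * star (e n (k, i, j)) = e n (k, i, i)\<close> to that row gives the scalar \<open>card J\<close>, while the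
  expansion of \<open>e n (k, i, i)\<close> only admits the scalars \<open>0\<close> and \<open>1\<close>.
\<close>
lemma dproj_mult_unit_Suc:
  assumes s: "(l, a) \<in> diag (Suc n)" and u: "(k, i, j) \<in> idx n"
  shows "dproj (Suc n) (l, a) * e n (k, i, j) \<in> insert 0 ((\<lambda>b. e (Suc n) (l, a, b)) ` {..<d (Suc n) l})"
proof -
  obtain T where T: "T \<subseteq> idx (Suc n)" "e n (k, i, j) = (\<Sum>v\<in>T. e (Suc n) v)"
    using refine[OF u] by blast
  have "(k, i, i) \<in> idx n" using u by simp
  then obtain T' where T': "T' \<subseteq> idx (Suc n)" "e n (k, i, i) = (\<Sum>v\<in>T'. e (Suc n) v)"
    using refine by blast
  have fT: "finite T" "finite T'" using T T' finite_idx finite_subset by blast+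
  define J where "J = {b. (l, a, b) \<in> T}"
  have "J \<subseteq> {..<d (Suc n) l}" using T(1) by (auto simp: J_def)
  then have J: "J \<subseteq> {..<d (Suc n) l}" "finite J" by (auto intro: finite_subset)
  let ?p = "dproj (Suc n) (l, a)" and ?e = "e (Suc n)"
  have pu: "?p * (\<Sum>v\<in>U. ?e v) = (\<Sum>b | (l, a, b) \<in> U. ?e (l, a, b))"
    if U: "U \<subseteq> idx (Suc n)" for U
  proof -
    have fU: "finite U" using U finite_idx finite_subset by blast
    have "?p * (\<Sum>v\<in>U. ?e v) = (\<Sum>v\<in>U. if fst v = l \<and> fst (snd v) = a then ?e v else 0)"
      unfolding sum_distrib_left
      using U s by (intro sum.cong refl) (auto simp: dproj_mult_unit)
    also have "\<dots> = (\<Sum>v\<in>{v\<in>U. fst v = l \<and> fst (snd v) = a}. ?e v)"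
      using fU by (simp add: sum.inter_filter)
    also have "\<dots> = (\<Sum>b | (l, a, b) \<in> U. ?e (l, a, b))"
      by (rule sum.reindex_bij_witness[of _ "\<lambda>b. (l, a, b)" "\<lambda>v. snd (snd v)"]) auto
    finally show ?thesis .
  qed
  have row: "?p * e n (k, i, j) = (\<Sum>b\<in>J. ?e (l, a, b))"
    using pu[OF T(1)] T(2) by (simp add: J_def)
  have "of_nat (card J) *\<^sub>C ?p = ?p * e n (k, i, i) * ?p"
  proof -
    have "(?p * e n (k, i, j)) * star (?p * e n (k, i, j)) = ?p * (e n (k, i, j) * e n (k, j, i)) * ?p"
      using u s by (simp add: star_mult dproj_star unit_star mult.assoc)
    also have "\<dots> = ?p * e n (k, i, i) * ?p" using u by (simp add: unit_mult)
    finally have "?p * e n (k, i, i) * ?p = (\<Sum>b\<in>J. \<Sum>b'\<in>J. ?e (l, a, b) * star (?e (l, a, b')))"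
      by (simp add: row star_sum sum_product)
    also have "\<dots> = (\<Sum>b\<in>J. \<Sum>b'\<in>J. if b' = b then ?p else 0)"
      using J s by (intro sum.cong refl) (auto simp: unit_star unit_mult dproj_def subset_iff)
    also have "\<dots> = (\<Sum>b\<in>J. ?p)" using J by simp
    also have "\<dots> = of_nat (card J) *\<^sub>C ?p"
      by (simp add: complex_vector.scale_sum_left[symmetric] sum_constant scaleC_one
          flip: complex_vector.sum_constant_scale)
    finally show ?thesis by simp
  qed
  moreover have "?p * e n (k, i, i) * ?p = (if (l, a, a) \<in> T' then ?p else 0)"
  proof -
    define J' where "J' = {b. (l, a, b) \<in> T'}"
    have "J' \<subseteq> {..<d (Suc n) l}" using T'(1) by (auto simp: J'_def)
    then have J': "J' \<subseteq> {..<d (Suc n) l}" "finite J'" by (auto intro: finite_subset)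
    have "?p * e n (k, i, i) * ?p = (\<Sum>b\<in>J'. ?e (l, a, b) * ?p)"
      using pu[OF T'(1)] T'(2) by (simp add: J'_def sum_distrib_right)
    also have "\<dots> = (\<Sum>b\<in>J'. if b = a then ?p else 0)"
    proof (intro sum.cong refl)
      fix b assume "b \<in> J'"
      then have "b < d (Suc n) l" using J' by auto
      then show "?e (l, a, b) * ?p = (if b = a then ?p else 0)"
        using s by (simp add: dproj_def unit_mult)
    qed
    finally show ?thesis using J' by (simp add: J'_def)
  qed
  ultimately have "of_nat (card J) *\<^sub>C ?p = 0 *\<^sub>C ?p \<or> of_nat (card J) *\<^sub>C ?p = 1 *\<^sub>C ?p"
    by (auto simp: scaleC_one)
  then have "of_nat (card J) = (0::complex) \<or> of_nat (card J) = (1::complex)"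
    using dproj_nonzero[OF s] by (simp only: complex_vector.scale_cancel_right) simp
  then have "card J = 0 \<or> card J = 1" by simp
  then have "J = {} \<or> (\<exists>b. J = {b})" using J(2) by (auto simp: card_1_singleton_iff)
  then show ?thesis using row J(1) by auto
qed

text \<open>
  The product \<open>v\<close> of the two projections, if nonzero, is a single matrix unit \<open>e N (l, a, b)\<close>. Then
  \<open>v * dproj N (l, a) = v * star v\<close> is nonzero, which forces \<open>b = a\<close>.
\<close>
lemma dproj_mult_dproj_if_row:
  assumes s: "(l, a) \<in> diag N" and t: "t \<in> diag n"
    and row: "dproj N (l, a) * dproj n t \<in> insert 0 ((\<lambda>b. e N (l, a, b)) ` {..<d N l})"
  shows "dproj N (l, a) * dproj n t \<in> {0, dproj N (l, a)}"
proof -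
  let ?s = "dproj N (l, a)" and ?t = "dproj n t"
  consider "?s * ?t = 0" | b where "b < d N l" "?s * ?t = e N (l, a, b)"
    using row by auto
  then show ?thesis
  proof cases
    case (2 b)
    have "?s * ?t * star (?s * ?t) = ?s"
      using 2 s by (simp add: unit_star unit_mult) (simp add: dproj_def)
    then have "?s * ?t * ?s = ?s"
      using t s by (simp add: star_mult dproj_star dproj_mult mult.assoc flip: mult.assoc[of ?t ?t])
    moreover have "e N (l, a, b) * ?s = (if a = b then ?s else 0)"
      using 2 s by (auto simp: unit_mult_dproj) (simp add: dproj_def)
    ultimately have "a = b" using 2 dproj_nonzero[OF s] by (auto split: if_splits)
    then show ?thesis using 2 by (simp add: dproj_def)
  qed simp
qed

text \<open>
  The row property between arbitrary levels. In the induction step the given minimal projection of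
  level \<open>Suc N\<close> is dominated by one minimal projection of level \<open>N\<close>, so that only one
  matrix unit of level \<open>N\<close> contributes to the row.
\<close>
lemma dproj_mult_unit_refined:
  assumes "n \<le> N" "(l, a) \<in> diag N" "(k, i, j) \<in> idx n"
  shows "dproj N (l, a) * e n (k, i, j) \<in> insert 0 ((\<lambda>b. e N (l, a, b)) ` {..<d N l})"
  using assms
proof (induction N arbitrary: l a rule: dec_induct)
  case base
  then show ?case by (auto simp: dproj_mult_unit)
next
  case (step N)
  let ?s = "(l, a)" and ?u = "(k, i, j)" and ?P = "dproj (Suc N)"
  have ps: "?P ?s * dproj N t \<in> {0, ?P ?s}" if t: "t \<in> diag N" for t
  proof (rule dproj_mult_dproj_if_row[OF step.prems(1) t])
    obtain k' i' where "t = (k', i')" "(k', i', i') \<in> idx N" using t by (cases t) auto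
    then show "?P ?s * dproj N t \<in> insert 0 ((\<lambda>b. e (Suc N) (l, a, b)) ` {..<d (Suc N) l})"
      using dproj_mult_unit_Suc[OF step.prems(1), of k' i' i'] by (simp add: dproj_def)
  qed
  have "\<exists>t\<in>diag N. ?P ?s * dproj N t \<noteq> 0"
  proof (rule ccontr)
    assume "\<not> ?thesis"
    then have "?P ?s * (\<Sum>t\<in>diag N. dproj N t) = 0" by (simp add: sum_distrib_left)
    then show False using dproj_nonzero[OF step.prems(1)] by (simp add: sum_dproj)
  qed
  then obtain t where t: "t \<in> diag N" "?P ?s * dproj N t = ?P ?s" using ps by auto
  obtain k' i' where t': "t = (k', i')" by (cases t)
  have eq: "?P ?s * e n ?u = ?P ?s * (dproj N t * e n ?u)" by (simp add: t(2) flip: mult.assoc)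
  have "dproj N t * e n ?u \<in> insert 0 ((\<lambda>b. e N (k', i', b)) ` {..<d N k'})"
    using step.IH[of k' i'] t(1) step.prems(2) by (simp add: t')
  then consider "dproj N t * e n ?u = 0" | b where "b < d N k'" "dproj N t * e n ?u = e N (k', i', b)" by auto
  then show ?case
  proof cases
    case (2 b)
    then have "(k', i', b) \<in> idx N" using t(1) t' by simp
    then show ?thesis using dproj_mult_unit_Suc[OF step.prems(1)] 2 eq by metis
  qed (simp add: eq)
qed

section \<open>Matrix units inside a closed subalgebra\<close>

lemma norm_unit:
  assumes "u \<in> idx n"
  shows "norm (e n u) = 1"
proof -
  obtain k i j where u: "u = (k, i, j)" "k < r n" "i < d n k" "j < d n k"
    using assms by (cases u) auto
  have "star (e n u) * e n u = dproj n (k, j)" using u by (simp add: unit_star unit_mult dproj_def)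
  then have "(norm (e n u))\<^sup>2 = 1"
    using cstar_identity[of "e n u"] norm_dproj[of "(k, j)" n] u by simp
  then show ?thesis using power2_eq_imp_eq[of "norm (e n u)" 1] by simp
qed

lemma dproj_mult_dproj_refined:
  assumes "n \<le> N" "s \<in> diag N" "t \<in> diag n"
  shows "dproj N s * dproj n t \<in> {0, dproj N s}"
proof -
  obtain l a where s: "s = (l, a)" by (cases s)
  obtain k i where t: "t = (k, i)" by (cases t)
  show ?thesis
    using dproj_mult_dproj_if_row[of l a N t n] dproj_mult_unit_refined[of n N l a k i i] assms
    by (simp add: s t dproj_def)
qed

text \<open>
  Conjugating a minimal diagonal projection by matrix units of a lower level yields matrix units,
  and diagonal ones when the two sides match: the product is of the form \<open>star v * w\<close> where
  \<open>v\<close> and \<open>w\<close> are zero or matrix units in the same row.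
\<close>
lemma conjugate_refined:
  assumes nN: "n \<le> N" and s: "s \<in> diag N" and u: "(k, i, j) \<in> idx n" "(k, i, m) \<in> idx n"
  shows "e n (k, j, i) * dproj N s * e n (k, i, m) \<in> insert 0 (e N ` idx N)"
    and "e n (k, j, i) * dproj N s * e n (k, i, j) \<in> insert 0 (dproj N ` diag N)"
proof -
  obtain l a where la: "s = (l, a)" "l < r N" "a < d N l" using s by (cases s) auto
  have eq: "e n (k, j, i) * dproj N s * e n (k, i, m') = star (dproj N s * e n (k, i, j)) * (dproj N s * e n (k, i, m'))"
    for m'
    using u s by (simp add: star_mult dproj_star unit_star dproj_mult mult.assoc flip: mult.assoc[of "dproj N s" "dproj N s"])
  have row: "dproj N s * e n (k, i, m') \<in> insert 0 ((\<lambda>b. e N (l, a, b)) ` {..<d N l})" if "m' = j \<or> m' = m" for m'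
    using dproj_mult_unit_refined[OF nN, of l a k i m'] s u that by (auto simp: la(1))
  show "e n (k, j, i) * dproj N s * e n (k, i, m) \<in> insert 0 (e N ` idx N)"
    unfolding eq using row[of j] row[of m] la by (auto simp: unit_star unit_mult)
  show "e n (k, j, i) * dproj N s * e n (k, i, j) \<in> insert 0 (dproj N ` diag N)"
    unfolding eq
  proof -
    consider "dproj N s * e n (k, i, j) = 0" | b where "b < d N l" "dproj N s * e n (k, i, j) = e N (l, a, b)"
      using row[of j] by auto
    then show "star (dproj N s * e n (k, i, j)) * (dproj N s * e n (k, i, j)) \<in> insert 0 (dproj N ` diag N)"
    proof cases
      case (2 b)
      then have "star (dproj N s * e n (k, i, j)) * (dproj N s * e n (k, i, j)) = dproj N (l, b)" "(l, b) \<in> diag N"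
        using la by (simp_all add: unit_star unit_mult dproj_def)
      then show ?thesis by blast
    qed simp
  qed
qed

text \<open>
  Let \<open>w = e N u\<close>. For \<open>m \<ge> N\<close> the sum of the compressions \<open>dproj m s * y * (star w * dproj m s * w)\<close>
  stays in \<open>A\<close>, since both outer factors are diagonal, and is close to a sum of multiples
  \<open>f s * (dproj m s * w)\<close>, since \<open>y\<close> is close to \<open>B m\<close>. Because \<open>y\<close> is nearer to \<open>c w\<close> than
  \<open>\<bar>c\<bar>\<close>, all scalars \<open>f s\<close> are bounded away from \<open>0\<close>; dividing by them produces elements of \<open>A\<close>
  that converge to \<open>w\<close>.
\<close>
lemma unit_in_bimodule:
  assumes A: "subalgebra A" "closed A" "\<And>m s. s \<in> diag m \<Longrightarrow> dproj m s \<in> A"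
    and u: "u \<in> idx N" and y: "y \<in> A" and near: "norm (y - c *\<^sub>C e N u) < cmod c"
  shows "e N u \<in> A"
proof -
  let ?w = "e N u"
  obtain k i j where kij: "u = (k, i, j)" "k < r N" "i < d N k" "j < d N k" using u by (cases u) auto
  have sw: "star ?w = e N (k, j, i)" using kij by (simp add: unit_star)
  have ww: "?w * star ?w = dproj N (k, i)" using kij by (simp add: unit_star unit_mult dproj_def)
  have nw: "norm ?w = 1" "norm (star ?w) = 1" using u by (simp_all add: norm_unit norm_star)
  define \<rho> where "\<rho> = cmod c - norm (y - c *\<^sub>C ?w)"
  have \<rho>: "\<rho> > 0" using near by (simp add: \<rho>_def)
  have sub: "complex_vector.subspace A" using A(1) by (rule subalgebraD)
  have approx: "\<exists>G\<in>A. norm (G - ?w) \<le> \<eta> / (\<rho> - \<eta>)" if \<eta>: "0 < \<eta>" "\<eta> < \<rho>" for \<eta>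
  proof -
    obtain m y' where m: "N \<le> m" "y' \<in> B m" "norm (y - y') < \<eta>" using B_dense[OF \<eta>(1)] by blast
    \<comment> \<open>the minimal projections of level \<open>m\<close> below the range projection of \<open>w\<close>\<close>
    define S where "S = {s \<in> diag m. dproj m s * ?w \<noteq> 0}"
    have S: "finite S" "S \<subseteq> diag m" by (auto simp: S_def finite_diag)
    have pS: "dproj m s * dproj N (k, i) = dproj m s" if "s \<in> S" for s
    proof -
      have "dproj N (k, i) * ?w = ?w" using kij by (simp add: dproj_mult_unit)
      then have "dproj m s * dproj N (k, i) * ?w \<noteq> 0" using that by (simp add: S_def mult.assoc)
      then show ?thesis using dproj_mult_dproj_refined[OF m(1), of s "(k, i)"] that kij by (auto simp: S_def)
    qed
    have sw_B: "star ?w \<in> B m"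
      unfolding sw using unit_in_B[of "(k, j, i)" N] B_mono[OF m(1)] kij by auto
    have "\<forall>s\<in>S. \<exists>c'. dproj m s * (y' * star ?w) * dproj m s = c' *\<^sub>C dproj m s"
      using S corner_scalar subalgebraD(2)[OF subalgebra_B m(2) sw_B] by blast
    then obtain f where f: "\<And>s. s \<in> S \<Longrightarrow> dproj m s * (y' * star ?w) * dproj m s = f s *\<^sub>C dproj m s"
      by metis
    have f_large: "\<rho> - \<eta> < cmod (f s)" if s: "s \<in> S" for s
    proof -
      have sd: "s \<in> diag m" using s S by auto
      have "dproj m s * (?w * star ?w) * dproj m s = dproj m s"
        using sd s by (simp add: ww pS dproj_mult)
      then have "(f s - c) *\<^sub>C dproj m s = dproj m s * (y' * star ?w) * dproj m s - c *\<^sub>C (dproj m s * (?w * star ?w) * dproj m s)"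
        by (simp add: f[OF s] complex_vector.scale_left_diff_distrib)
      also have "\<dots> = dproj m s * ((y' - c *\<^sub>C ?w) * star ?w) * dproj m s"
        by (simp add: algebra_simps mult_scaleC_left mult_scaleC_right)
      finally have "norm ((f s - c) *\<^sub>C dproj m s) = norm (dproj m s * ((y' - c *\<^sub>C ?w) * star ?w) * dproj m s)" by simp
      also have "\<dots> \<le> norm ((y' - c *\<^sub>C ?w) * star ?w)"
        using norm_dproj[OF sd] by (intro order_trans[OF norm_mult_le_left norm_mult_le_right]) auto
      also have "\<dots> \<le> norm (y' - c *\<^sub>C ?w)" using nw by (intro norm_mult_le_left) simp
      also have "\<dots> < norm (y - c *\<^sub>C ?w) + \<eta>"
        using m(3) norm_triangle_ineq[of "y' - y" "y - c *\<^sub>C ?w"] by (simp add: norm_minus_commute)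
      finally have "cmod (f s - c) < norm (y - c *\<^sub>C ?w) + \<eta>" using norm_dproj[OF sd] by (simp add: norm_scaleC)
      then show ?thesis
        using norm_triangle_ineq2[of c "f s"] by (simp add: \<rho>_def norm_minus_commute)
    qed
    have f0: "f s \<noteq> 0" if "s \<in> S" for s using f_large[OF that] \<eta> by auto
    define g where "g = (\<lambda>z s. inverse (f s) *\<^sub>C (dproj m s * z * (star ?w * dproj m s * ?w)))"
    define G where "G = (\<Sum>s\<in>S. g y s)"
    have conj_A: "star ?w * dproj m s * ?w \<in> A" if "s \<in> S" for s
    proof -
      have "star ?w * dproj m s * ?w \<in> insert 0 (dproj m ` diag m)"
        unfolding sw using conjugate_refined(2)[OF m(1), of s k i j j] that S kij by auto
      then show ?thesis using A(3) complex_vector.subspace_0[OF sub] by auto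
    qed
    have "G \<in> A"
      unfolding G_def g_def
    proof (intro complex_vector.subspace_sum complex_vector.subspace_scale sub)
      fix s assume s: "s \<in> S"
      then have "dproj m s \<in> A" using S by (intro A(3)) blast
      then show "dproj m s * y * (star ?w * dproj m s * ?w) \<in> A"
        by (rule subalgebraD(2)[OF A(1) subalgebraD(2)[OF A(1) _ y] conj_A[OF s]])
    qed
    have "?w = (\<Sum>s\<in>diag m. dproj m s * ?w)" by (simp add: sum_dproj flip: sum_distrib_right)
    also have "\<dots> = (\<Sum>s\<in>S. dproj m s * ?w)"
      by (rule sum.mono_neutral_right) (auto simp: S_def finite_diag)
    also have "\<dots> = (\<Sum>s\<in>S. g y' s)"
    proof (rule sum.cong[OF refl])
      fix s assume s: "s \<in> S"
      have "dproj m s * y' * (star ?w * dproj m s * ?w) = dproj m s * (y' * star ?w) * dproj m s * ?w"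
        by (simp add: mult.assoc)
      then show "dproj m s * ?w = g y' s"
        using f[OF s] f0[OF s] by (simp add: g_def mult_scaleC_left scaleC_scaleC scaleC_one)
    qed
    finally have "G - ?w = (\<Sum>s\<in>S. g y s - g y' s)" by (simp add: G_def sum_subtractf)
    also have "\<dots> = (\<Sum>s\<in>S. g (y - y') s)"
      by (simp add: g_def left_diff_distrib right_diff_distrib complex_vector.scale_right_diff_distrib)
    also have "norm \<dots> \<le> \<eta> / (\<rho> - \<eta>)"
    proof (rule norm_orthogonal_sum_le[OF S(1)])
      show "0 \<le> \<eta> / (\<rho> - \<eta>)" using \<eta> by simp
    next
      fix s assume s: "s \<in> S"
      then have np: "norm (dproj m s) = 1" using S by (intro norm_dproj) blast
      have "norm (star ?w * dproj m s * ?w) \<le> norm (star ?w * dproj m s)" using nw by (intro norm_mult_le_left) simp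
      also have "\<dots> \<le> 1" using np nw norm_mult_ineq[of "star ?w" "dproj m s"] by simp
      finally have "norm (dproj m s * (y - y') * (star ?w * dproj m s * ?w)) \<le> norm (dproj m s * (y - y'))"
        by (rule norm_mult_le_left)
      also have "\<dots> \<le> norm (y - y')" using np by (intro norm_mult_le_right) simp
      finally have "norm (dproj m s * (y - y') * (star ?w * dproj m s * ?w)) \<le> \<eta>" using m(3) by simp
      moreover have "inverse (cmod (f s)) \<le> inverse (\<rho> - \<eta>)"
        using f_large[OF s] \<eta> by (intro le_imp_inverse_le) auto
      ultimately have "inverse (cmod (f s)) * norm (dproj m s * (y - y') * (star ?w * dproj m s * ?w))
          \<le> inverse (\<rho> - \<eta>) * \<eta>"
        using \<eta> by (intro mult_mono) auto
      then show "norm (g (y - y') s) \<le> \<eta> / (\<rho> - \<eta>)"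
        by (simp add: g_def norm_scaleC norm_inverse divide_inverse mult.commute)
    next
      fix s t assume st: "s \<in> S" "t \<in> S" "s \<noteq> t"
      have d: "s \<in> diag m" "t \<in> diag m" using st S by auto
      have pp: "dproj m s * (dproj m t * z) = 0" for z
        using dproj_mult[OF d] st by (simp flip: mult.assoc)
      show "star (g (y - y') s) * g (y - y') t = 0"
        by (simp add: g_def star_mult star_scaleC dproj_star d mult_scaleC_left mult_scaleC_right mult.assoc pp)
      have "dproj m s * (?w * (star ?w * (dproj m t * z))) = dproj m s * (dproj m t * z)" for z
        using pS[OF st(1)] ww by (metis mult.assoc)
      then show "g (y - y') s * star (g (y - y') t) = 0"
        by (simp add: g_def star_mult star_scaleC star_star dproj_star d mult_scaleC_left mult_scaleC_right mult.assoc pp)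
    qed
    finally show ?thesis using \<open>G \<in> A\<close> by blast
  qed
  have "\<exists>G\<in>A. dist G ?w < \<epsilon>" if \<epsilon>: "\<epsilon> > 0" for \<epsilon>
  proof -
    \<comment> \<open>this choice gives \<open>\<eta> / (\<rho> - \<eta>) \<le> \<epsilon> / 2\<close>\<close>
    define \<eta> where "\<eta> = min (\<rho> / 2) (\<epsilon> * \<rho> / 4)"
    have \<eta>: "0 < \<eta>" "\<eta> < \<rho>" "\<rho> / 2 \<le> \<rho> - \<eta>" "\<eta> \<le> \<epsilon> * \<rho> / 4"
      using \<epsilon> \<rho> by (auto simp: \<eta>_def min_def)
    have "\<eta> / (\<rho> - \<eta>) \<le> (\<epsilon> * \<rho> / 4) / (\<rho> / 2)"
      using \<eta> \<rho> by (intro frac_le) auto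
    also have "\<dots> < \<epsilon>" using \<rho> \<epsilon> by simp
    finally show ?thesis using approx[OF \<eta>(1,2)] by (force simp: dist_norm)
  qed
  then have "?w \<in> closure A" by (simp add: closure_approachable)
  then show ?thesis using A(2) by simp
qed

section \<open>Pinching onto copies of a lower level\<close>

text \<open>
  If \<open>s\<close> is a minimal projection of level \<open>N\<close> below \<open>e n (k, 0, 0)\<close>, it selects one of the copies of
  the \<open>k\<close>-th block of \<open>B n\<close> inside \<open>B N\<close>, and \<open>copy_proj n N (k, s)\<close> is the unit of that copy. For the
  other \<open>s\<close> it is \<open>0\<close>, which allows all pairs \<open>(k, s)\<close> as indices.
\<close>
definition copy_proj :: "nat \<Rightarrow> nat \<Rightarrow> nat \<times> nat \<times> nat \<Rightarrow> 'a" where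
  "copy_proj n N = (\<lambda>(k, s). \<Sum>i<d n k. e n (k, i, 0) * dproj N s * e n (k, 0, i))"

abbreviation "copies n N \<equiv> {..<r n} \<times> diag N"

lemma dproj_middle:
  assumes "n \<le> N" "s \<in> diag N" "t \<in> diag N" "k < r n" "i < d n k"
  shows "dproj N s * (e n (k, 0, 0) * (dproj N t * e n (k, 0, i))) = (if s = t then dproj N s * e n (k, 0, i) else 0)"
proof -
  have k: "(k, 0) \<in> diag n" using assms by auto
  have "dproj N s * dproj n (k, 0) \<in> {0, dproj N s}" using assms k by (intro dproj_mult_dproj_refined)
  then show ?thesis
  proof
    assume 0: "dproj N s * dproj n (k, 0) = 0"
    then have "dproj N s * e n (k, 0, 0) = 0" by (simp add: dproj_def[of n])
    moreover have "dproj N s * e n (k, 0, i) = dproj N s * e n (k, 0, 0) * e n (k, 0, i)"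
      using assms by (simp add: unit_mult mult.assoc)
    ultimately show ?thesis by (cases "s = t") (simp_all flip: mult.assoc)
  next
    assume "dproj N s * dproj n (k, 0) \<in> {dproj N s}"
    then have "dproj N s * e n (k, 0, 0) = dproj N s" by (simp add: dproj_def[of n])
    then have "dproj N s * (e n (k, 0, 0) * (dproj N t * e n (k, 0, i))) = dproj N s * dproj N t * e n (k, 0, i)"
      by (simp flip: mult.assoc)
    then show ?thesis using assms by (simp add: dproj_mult)
  qed
qed

text \<open>
  Copies belonging to different indices are orthogonal: after the matrix units of level \<open>n\<close> have
  been multiplied out, \<open>dproj_middle\<close> decides the remaining product of minimal projections.
\<close>
lemma copy_proj_mult:
  assumes nN: "n \<le> N" and "a \<in> copies n N" "b \<in> copies n N"
  shows "copy_proj n N a * copy_proj n N b = (if a = b then copy_proj n N a else 0)"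
proof -
  obtain k s l t where ab: "a = (k, s)" "b = (l, t)" by (cases a, cases b)
  have kl: "k < r n" "l < r n" "s \<in> diag N" "t \<in> diag N" using assms by (auto simp: ab)
  have "copy_proj n N a * copy_proj n N b = (\<Sum>i<d n k. \<Sum>j<d n l. if k = l \<and> i = j \<and> s = t then e n (k, i, 0) * dproj N s * e n (k, 0, i) else 0)"
    unfolding copy_proj_def ab prod.case sum_product
  proof (intro sum.cong refl)
    fix i j assume ij: "i \<in> {..<d n k}" "j \<in> {..<d n l}"
    have "e n (k, 0, i) * (e n (l, j, 0) * z) = (if k = l \<and> i = j then e n (k, 0, 0) * z else 0)" for z
    proof -
      have "0 < d n k" "0 < d n l" using ij by auto
      then show ?thesis using ij kl unit_mult[of k n 0 i l j 0] by (simp flip: mult.assoc)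
    qed
    then show "e n (k, i, 0) * dproj N s * e n (k, 0, i) * (e n (l, j, 0) * dproj N t * e n (l, 0, j)) =
        (if k = l \<and> i = j \<and> s = t then e n (k, i, 0) * dproj N s * e n (k, 0, i) else 0)"
      using dproj_middle[OF nN kl(3,4), of k j] kl ij by (auto simp: mult.assoc)
  qed
  also have "\<dots> = (if a = b then copy_proj n N a else 0)"
    by (auto simp: copy_proj_def ab intro!: sum.cong)
  finally show ?thesis .
qed

lemma copy_proj_star: "a \<in> copies n N \<Longrightarrow> star (copy_proj n N a) = copy_proj n N a"
  by (cases a) (auto simp: copy_proj_def star_sum star_mult unit_star dproj_star mult.assoc intro!: sum.cong)

lemma norm_copy_proj:
  assumes "n \<le> N" "a \<in> copies n N"
  shows "norm (copy_proj n N a) \<le> 1"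
  using assms norm_projection[of "copy_proj n N a"] by (cases "copy_proj n N a = 0") (auto simp: copy_proj_star copy_proj_mult)

lemma sum_copy_proj: "(\<Sum>a\<in>copies n N. copy_proj n N a) = 1"
proof -
  have "(\<Sum>a\<in>copies n N. copy_proj n N a) = (\<Sum>k<r n. \<Sum>s\<in>diag N. \<Sum>i<d n k. e n (k, i, 0) * dproj N s * e n (k, 0, i))"
    by (subst sum.cartesian_product) (simp add: copy_proj_def split_def)
  also have "\<dots> = (\<Sum>k<r n. \<Sum>i<d n k. e n (k, i, 0) * (\<Sum>s\<in>diag N. dproj N s) * e n (k, 0, i))"
    by (subst sum.swap) (simp add: sum_distrib_left sum_distrib_right)
  also have "\<dots> = (\<Sum>k<r n. \<Sum>i<d n k. dproj n (k, i))"
    unfolding sum_dproj by (intro sum.cong refl) (simp add: unit_mult dproj_def)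
  also have "\<dots> = 1"
    using sum_dproj[of n] by (simp add: diag_def sum.Sigma)
  finally show ?thesis .
qed

lemma copy_proj_commute:
  assumes y: "y \<in> B n" and a: "a \<in> copies n N"
  shows "copy_proj n N a * y = y * copy_proj n N a"
proof -
  obtain k s where ks: "a = (k, s)" "k < r n" using a by auto
  have "y \<in> complex_vector.span (e n ` idx n)" using y by (simp add: span_units)
  then show ?thesis
  proof (induction rule: complex_vector.span_induct_alt)
    case (step c x y)
    then obtain l i j where u: "x = e n (l, i, j)" "l < r n" "i < d n l" "j < d n l" by auto
    let ?m = "if k = l then e n (l, i, 0) * dproj N s * e n (l, 0, j) else 0"
    have "copy_proj n N a * x = (\<Sum>m<d n k. if m = i then ?m else 0)"
      unfolding copy_proj_def ks prod.case sum_distrib_right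
      using u ks(2) by (intro sum.cong refl) (auto simp: unit_mult mult.assoc)
    also have "\<dots> = ?m" using u by simp
    also have "\<dots> = (\<Sum>m<d n k. if m = j then ?m else 0)" using u by simp
    also have "\<dots> = x * copy_proj n N a"
      unfolding copy_proj_def ks prod.case sum_distrib_left
      using u ks(2) by (intro sum.cong refl) (auto simp: unit_mult simp flip: mult.assoc)
    finally show ?case
      using step by (simp add: distrib_left distrib_right mult_scaleC_left mult_scaleC_right)
  qed simp
qed

definition pinch :: "nat \<Rightarrow> nat \<Rightarrow> 'a \<Rightarrow> 'a" where
  "pinch n N y = (\<Sum>a\<in>copies n N. copy_proj n N a * y * copy_proj n N a)"

lemma pinch_diff: "pinch n N (x - y) = pinch n N x - pinch n N y"
  by (simp add: pinch_def left_diff_distrib right_diff_distrib sum_subtractf)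

text \<open>
  The summands are supported on orthogonal projections on either side, so
  \<open>norm_orthogonal_sum_le\<close> applies.
\<close>
lemma norm_pinch:
  assumes nN: "n \<le> N"
  shows "norm (pinch n N y) \<le> norm y"
  unfolding pinch_def
proof (rule norm_orthogonal_sum_le)
  fix a assume a: "a \<in> copies n N"
  show "norm (copy_proj n N a * y * copy_proj n N a) \<le> norm y"
    using norm_copy_proj[OF nN a] by (intro order_trans[OF norm_mult_le_left norm_mult_le_right])
next
  fix a b assume ab: "a \<in> copies n N" "b \<in> copies n N" "a \<noteq> b"
  have 0: "copy_proj n N a * (copy_proj n N b * z) = 0" for z
    using copy_proj_mult[OF nN ab(1,2)] ab(3) by (simp flip: mult.assoc)
  show "star (copy_proj n N a * y * copy_proj n N a) * (copy_proj n N b * y * copy_proj n N b) = 0"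
    "copy_proj n N a * y * copy_proj n N a * star (copy_proj n N b * y * copy_proj n N b) = 0"
    by (simp_all only: star_mult copy_proj_star[OF ab(1)] copy_proj_star[OF ab(2)] mult.assoc 0 mult_zero_right)
qed (simp_all add: finite_diag)

lemma pinch_eq_self:
  assumes "n \<le> N" "y \<in> B n"
  shows "pinch n N y = y"
proof -
  have "pinch n N y = (\<Sum>a\<in>copies n N. y * copy_proj n N a)"
    unfolding pinch_def using assms by (intro sum.cong refl) (simp add: copy_proj_commute copy_proj_mult mult.assoc)
  then show ?thesis by (simp add: sum_copy_proj flip: sum_distrib_left)
qed

text \<open>
  The coefficient of \<open>y\<close> at the piece \<open>subunit n N (k, i, j) s\<close> of the matrix unit
  \<open>e n (k, i, j)\<close>. It exists for \<open>y\<close> in \<open>B N\<close> because the corner at a minimal projection is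
  one-dimensional.
\<close>
definition corner_coeff :: "nat \<Rightarrow> nat \<Rightarrow> 'a \<Rightarrow> nat \<times> nat \<times> nat \<Rightarrow> nat \<times> nat \<Rightarrow> complex" where
  "corner_coeff n N y = (\<lambda>(k, i, j) s.
     SOME c. dproj N s * (e n (k, 0, i) * y * e n (k, j, 0)) * dproj N s = c *\<^sub>C dproj N s)"

definition subunit :: "nat \<Rightarrow> nat \<Rightarrow> nat \<times> nat \<times> nat \<Rightarrow> nat \<times> nat \<Rightarrow> 'a" where
  "subunit n N = (\<lambda>(k, i, j) s. e n (k, i, 0) * dproj N s * e n (k, 0, j))"

lemma corner_coeff:
  assumes nN: "n \<le> N" and y: "y \<in> B N" and u: "(k, i, j) \<in> idx n" and s: "s \<in> diag N"
  shows "dproj N s * (e n (k, 0, i) * y * e n (k, j, 0)) * dproj N s = corner_coeff n N y (k, i, j) s *\<^sub>C dproj N s"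
proof -
  have "(k, 0, i) \<in> idx n" "(k, j, 0) \<in> idx n" using u by auto
  then have "e n (k, 0, i) * y * e n (k, j, 0) \<in> B N"
    using unit_in_B[of _ n] B_mono[OF nN] y by (intro subalgebraD(2)[OF subalgebra_B]) blast+
  from someI_ex[OF corner_scalar[OF s this]] show ?thesis by (simp add: corner_coeff_def)
qed

lemma corner_subunit:
  assumes nN: "n \<le> N" and y: "y \<in> B N" and u: "(k, i, j) \<in> idx n" and s: "s \<in> diag N"
  shows "e n (k, i, 0) * dproj N s * e n (k, 0, i) * y * (e n (k, j, 0) * dproj N s * e n (k, 0, j)) =
    corner_coeff n N y (k, i, j) s *\<^sub>C subunit n N (k, i, j) s"
proof -
  have "e n (k, i, 0) * dproj N s * e n (k, 0, i) * y * (e n (k, j, 0) * dproj N s * e n (k, 0, j)) =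
      e n (k, i, 0) * (dproj N s * (e n (k, 0, i) * y * e n (k, j, 0)) * dproj N s) * e n (k, 0, j)"
    by (simp only: mult.assoc)
  then show ?thesis
    by (simp only: corner_coeff[OF assms] subunit_def prod.case mult_scaleC_left mult_scaleC_right)
qed

text \<open>
  Compressed to one copy, \<open>B N\<close> shrinks to a full matrix algebra spanned by the corresponding
  pieces of the matrix units of level \<open>n\<close>.
\<close>
lemma pinch_expansion:
  assumes nN: "n \<le> N" and y: "y \<in> B N"
  shows "pinch n N y = (\<Sum>u\<in>idx n. \<Sum>s\<in>diag N. corner_coeff n N y u s *\<^sub>C subunit n N u s)"
proof -
  let ?c = "\<lambda>u s. corner_coeff n N y u s *\<^sub>C subunit n N u s"
  have sum_triple: "(\<Sum>u\<in>(SIGMA k:{..<r n}. {..<d n k} \<times> {..<d n k}). F u) =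
      (\<Sum>k<r n. \<Sum>i<d n k. \<Sum>j<d n k. F (k, i, j))" for F :: "_ \<Rightarrow> 'a"
  proof -
    have "(\<Sum>k<r n. \<Sum>i<d n k. \<Sum>j<d n k. F (k, i, j)) =
        (\<Sum>k<r n. \<Sum>ij\<in>{..<d n k} \<times> {..<d n k}. F (k, ij))"
      by (intro sum.cong refl, subst sum.cartesian_product) (simp add: split_def)
    also have "\<dots> = (\<Sum>u\<in>(SIGMA k:{..<r n}. {..<d n k} \<times> {..<d n k}). F u)"
      by (subst sum.Sigma) (simp_all add: split_def)
    finally show ?thesis by simp
  qed
  have "pinch n N y = (\<Sum>k<r n. \<Sum>s\<in>diag N. copy_proj n N (k, s) * y * copy_proj n N (k, s))"
    unfolding pinch_def by (subst sum.cartesian_product) (simp add: split_def)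
  also have "\<dots> = (\<Sum>k<r n. \<Sum>s\<in>diag N. \<Sum>i<d n k. \<Sum>j<d n k. ?c (k, i, j) s)"
  proof (intro sum.cong refl)
    fix k s assume ks: "k \<in> {..<r n}" "s \<in> diag N"
    have "copy_proj n N (k, s) * y * copy_proj n N (k, s) = (\<Sum>i<d n k. \<Sum>j<d n k.
        e n (k, i, 0) * dproj N s * e n (k, 0, i) * y * (e n (k, j, 0) * dproj N s * e n (k, 0, j)))"
      unfolding copy_proj_def prod.case sum_distrib_right[of _ _ y] by (rule sum_product)
    also have "\<dots> = (\<Sum>i<d n k. \<Sum>j<d n k. ?c (k, i, j) s)"
      by (intro sum.cong refl corner_subunit[OF nN y]) (use ks in auto)
    finally show "copy_proj n N (k, s) * y * copy_proj n N (k, s) = (\<Sum>i<d n k. \<Sum>j<d n k. ?c (k, i, j) s)" .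
  qed
  also have "\<dots> = (\<Sum>k<r n. \<Sum>i<d n k. \<Sum>j<d n k. \<Sum>s\<in>diag N. ?c (k, i, j) s)"
    by (intro sum.cong refl) (simp add: sum.swap[of _ "diag N"])
  also have "\<dots> = (\<Sum>u\<in>(SIGMA k:{..<r n}. {..<d n k} \<times> {..<d n k}). \<Sum>s\<in>diag N. ?c u s)"
    unfolding sum_triple ..
  also have "(SIGMA k:{..<r n}. {..<d n k} \<times> {..<d n k}) = idx n" by (auto simp: matrix_unit_index_def)
  finally show ?thesis .
qed

lemma subunit_cases:
  assumes "n \<le> N" "u \<in> idx n" "s \<in> diag N"
  shows "subunit n N u s \<in> insert 0 (e N ` idx N)"
proof -
  obtain k i j where "u = (k, i, j)" "(k, 0, i) \<in> idx n" "(k, 0, j) \<in> idx n" using assms by (cases u) auto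
  then show ?thesis using conjugate_refined(1)[OF assms(1,3)] by (simp add: subunit_def)
qed

text \<open>
  Different pieces of one matrix unit have orthogonal ranges and orthogonal supports, so
  the norm of a linear combination of them is at most the largest modulus of a coefficient.
\<close>
lemma subunit_mult_star:
  assumes "n \<le> N" "(k, i, j) \<in> idx n" "s \<in> diag N" "t \<in> diag N"
  shows "subunit n N (k, i, j) s * star (subunit n N (k, i, j) t) =
      (if s = t then e n (k, i, 0) * dproj N s * e n (k, 0, i) else 0)"
    and "star (subunit n N (k, i, j) s) * subunit n N (k, i, j) t =
      (if s = t then e n (k, j, 0) * dproj N s * e n (k, 0, j) else 0)"
proof -
  have *: "e n (k, 0, m) * (e n (k, m, 0) * z) = e n (k, 0, 0) * z" if "m < d n k" for m z
    using that assms(2) unit_mult[of k n 0 m k m 0] by (simp flip: mult.assoc)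
  have st: "star (subunit n N (k, i, j) t) = e n (k, j, 0) * (dproj N t * e n (k, 0, i))" if "t \<in> diag N" for t
    using assms(2) that by (simp add: subunit_def star_mult unit_star dproj_star)
  show "subunit n N (k, i, j) s * star (subunit n N (k, i, j) t) =
      (if s = t then e n (k, i, 0) * dproj N s * e n (k, 0, i) else 0)"
    using assms(2) dproj_middle[OF assms(1,3,4), of k i]
    by (cases "s = t"; simp add: st assms(3,4); simp add: subunit_def mult.assoc *)
  show "star (subunit n N (k, i, j) s) * subunit n N (k, i, j) t =
      (if s = t then e n (k, j, 0) * dproj N s * e n (k, 0, j) else 0)"
    using assms(2) dproj_middle[OF assms(1,3,4), of k j]
    by (cases "s = t"; simp add: st assms(3,4); simp add: subunit_def mult.assoc *)
qed

text \<open>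
  Choose first \<open>b\<close> in \<open>B n\<close> near \<open>x\<close>, then a much better approximant \<open>z\<close> in some \<open>B N\<close>. The pinching
  of \<open>z\<close> is near \<open>b\<close>, since pinching is contractive and fixes \<open>b\<close>. Those of its
  coefficients that exceed \<open>\<delta>\<close> belong to matrix units in \<open>A\<close> by \<open>unit_in_bimodule\<close>; keeping just
  these changes it by at most \<open>card (idx n) * \<delta>\<close>.
\<close>
lemma closed_subalgebra_inductive:
  assumes A: "subalgebra A" "closed A" "\<And>m s. s \<in> diag m \<Longrightarrow> dproj m s \<in> A"
    and x: "x \<in> A" and \<epsilon>: "\<epsilon> > 0"
  shows "\<exists>N. \<exists>y\<in>A \<inter> B N. norm (x - y) < \<epsilon>"
proof -
  obtain n b where n: "b \<in> B n" "norm (x - b) < \<epsilon> / 4" using B_dense[of "\<epsilon> / 4" 0 x] \<epsilon> by auto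
  \<comment> \<open>\<open>\<delta>\<close> may depend on the size of level \<open>n\<close>, but not on that of level \<open>N\<close>\<close>
  define \<delta> where "\<delta> = \<epsilon> / 4 / (card (idx n) + 1)"
  have \<delta>: "\<delta> > 0" "\<delta> \<le> \<epsilon> / 4" "card (idx n) * \<delta> \<le> \<epsilon> / 4"
    using \<epsilon> by (auto simp: \<delta>_def field_simps)
  obtain N z where N: "n \<le> N" "z \<in> B N" "norm (x - z) < \<delta>" using B_dense[OF \<delta>(1)] by blast
  have sub: "complex_vector.subspace A" using A(1) by (rule subalgebraD)
  define c where "c = corner_coeff n N z"
  define W where "W = subunit n N"
  have W_A: "W u s \<in> A" if u: "u \<in> idx n" and s: "s \<in> diag N" and big: "\<delta> < cmod (c u s)" for u s
  proof (cases "W u s = 0")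
    case True
    then show ?thesis using complex_vector.subspace_0[OF sub] by simp
  next
    case False
    then obtain v where v: "v \<in> idx N" "W u s = e N v"
      using subunit_cases[OF N(1) u s] by (auto simp: W_def)
    obtain k i j where kij: "u = (k, i, j)" by (cases u)
    let ?l = "e n (k, i, 0) * dproj N s * e n (k, 0, i)" and ?r = "e n (k, j, 0) * dproj N s * e n (k, 0, j)"
    have l: "?l = W u s * star (W u s)" "?r = star (W u s) * W u s"
      using subunit_mult_star[OF N(1), of k i j s s] u s by (simp_all add: W_def kij)
    have norm_lr: "norm ?l \<le> 1" "norm ?r \<le> 1"
      using norm_mult_ineq[of "W u s" "star (W u s)"] norm_mult_ineq[of "star (W u s)" "W u s"] v
      unfolding l by (simp_all add: norm_star norm_unit)
    have lr_A: "?l \<in> A" "?r \<in> A"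
      using conjugate_refined(2)[OF N(1) s, of k 0 i i] conjugate_refined(2)[OF N(1) s, of k 0 j j]
        u A(3) complex_vector.subspace_0[OF sub] by (auto simp: kij)
    have "?l * x * ?r - c u s *\<^sub>C W u s = ?l * (x - z) * ?r"
      using corner_subunit[OF N(1,2), of k i j s] u s
      by (simp add: c_def W_def kij left_diff_distrib right_diff_distrib)
    also have "norm \<dots> \<le> norm (x - z)"
      using norm_lr by (intro order_trans[OF norm_mult_le_left norm_mult_le_right])
    finally have "norm (?l * x * ?r - c u s *\<^sub>C e N v) < cmod (c u s)" using N(3) big v by simp
    moreover have "?l * x * ?r \<in> A" 
      by (rule subalgebraD(2)[OF A(1) subalgebraD(2)[OF A(1) lr_A(1) x] lr_A(2)])
    ultimately show ?thesis using unit_in_bimodule[OF A v(1)] v(2) by simp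
  qed
  define y where "y = (\<Sum>u\<in>idx n. \<Sum>s\<in>{s \<in> diag N. \<delta> < cmod (c u s)}. c u s *\<^sub>C W u s)"
  have "W u s \<in> B N" if "u \<in> idx n" "s \<in> diag N" for u s
    using subunit_cases[OF N(1) that] unit_in_B complex_vector.subspace_0[OF subalgebraD(1)[OF subalgebra_B]]
    by (auto simp: W_def)
  then have "y \<in> B N"
    unfolding y_def
    by (intro complex_vector.subspace_sum complex_vector.subspace_scale subalgebraD(1)[OF subalgebra_B]) auto
  moreover have "y \<in> A"
    unfolding y_def by (intro complex_vector.subspace_sum complex_vector.subspace_scale sub) (auto intro: W_A)
  moreover have "norm (x - y) < \<epsilon>"
  proof -
    have "pinch n N z - y = (\<Sum>u\<in>idx n. \<Sum>s\<in>{s \<in> diag N. \<not> \<delta> < cmod (c u s)}. c u s *\<^sub>C W u s)"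
    proof -
      have "(\<Sum>s\<in>diag N. f s) - (\<Sum>s\<in>{s \<in> diag N. P s}. f s) = (\<Sum>s\<in>{s \<in> diag N. \<not> P s}. f s)"
        for f :: "_ \<Rightarrow> 'a" and P
      proof -
        have "diag N - {s \<in> diag N. P s} = {s \<in> diag N. \<not> P s}" by auto
        then show ?thesis using sum_diff[OF finite_diag, of "{s \<in> diag N. P s}" N f] by auto
      qed
      then show ?thesis
        unfolding pinch_expansion[OF N(1,2)] y_def c_def W_def by (simp only: flip: sum_subtractf)
    qed
    also have "norm \<dots> \<le> (\<Sum>u\<in>idx n. \<delta>)"
    proof (rule sum_norm_le, rule norm_orthogonal_sum_le)
      fix u s assume u: "u \<in> idx n" and s: "s \<in> {s \<in> diag N. \<not> \<delta> < cmod (c u s)}"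
      have "norm (W u s) \<le> 1"
        using subunit_cases[OF N(1) u] s norm_unit by (fastforce simp: W_def)
      then show "norm (c u s *\<^sub>C W u s) \<le> \<delta>"
        using s \<delta>(1) mult_mono[of "cmod (c u s)" \<delta> "norm (W u s)" 1] by (simp add: norm_scaleC)
    next
      fix u s t assume u: "u \<in> idx n" and st: "s \<in> {s \<in> diag N. \<not> \<delta> < cmod (c u s)}"
        "t \<in> {s \<in> diag N. \<not> \<delta> < cmod (c u s)}" "s \<noteq> t"
      obtain k i j where kij: "u = (k, i, j)" by (cases u)
      show "star (c u s *\<^sub>C W u s) * (c u t *\<^sub>C W u t) = 0" "c u s *\<^sub>C W u s * star (c u t *\<^sub>C W u t) = 0"
        using subunit_mult_star[OF N(1), of k i j s t] st u
        by (simp_all add: kij W_def star_scaleC mult_scaleC_left mult_scaleC_right)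
    qed (use \<delta> finite_diag in auto)
    finally have 1: "norm (pinch n N z - y) \<le> \<epsilon> / 4" using \<delta>(3) by simp
    have "norm (b - pinch n N z) \<le> norm (b - z)"
      using norm_pinch[OF N(1), of "b - z"] by (simp add: pinch_diff pinch_eq_self[OF N(1) n(1)])
    also have "\<dots> < \<epsilon> / 2"
      using norm_triangle_ineq[of "b - x" "x - z"] n(2) N(3) \<delta>(2) by (simp add: norm_minus_commute)
    finally have "norm (b - y) < \<epsilon> / 2 + \<epsilon> / 4"
      using 1 norm_triangle_ineq[of "b - pinch n N z" "pinch n N z - y"] by simp
    then show ?thesis using n(2) norm_triangle_ineq[of "x - b" "b - y"] by simp
  qed
  ultimately show ?thesis by blast
qed

end

section \<open>Similarities along a path of invertible elements\<close>

text \<open>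
  Continuity of inversion, from \<open>c - c0 = c * (g0 - g) * c0\<close>: once \<open>\<parallel>g0 - g\<parallel> * \<parallel>c0\<parallel> < 1/2\<close>, this
  identity bounds \<open>\<parallel>c\<parallel>\<close> by \<open>2 * \<parallel>c0\<parallel>\<close>, and then shows convergence.
\<close>
lemma tendsto_one_sided_inverse:
  fixes g c :: "'b \<Rightarrow> 'a::{real_normed_algebra_1}"
  assumes g: "(g \<longlongrightarrow> g0) F" and inv: "\<forall>\<^sub>F t in F. c t * g t = 1" and inv0: "g0 * c0 = 1"
  shows "(c \<longlongrightarrow> c0) F"
proof -
  let ?u = "\<lambda>t. norm (g0 - g t)"
  have u: "(?u \<longlongrightarrow> 0) F"
    using tendsto_norm[OF tendsto_diff[OF tendsto_const g, of g0]] by simp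
  then have "((\<lambda>t. ?u t * norm c0) \<longlongrightarrow> 0) F" by (intro tendsto_mult_left_zero)
  then have small: "\<forall>\<^sub>F t in F. ?u t * norm c0 < 1 / 2"
    by (rule order_tendstoD) simp
  have "\<forall>\<^sub>F t in F. norm (c t - c0) \<le> 2 * norm c0 * (?u t * norm c0)"
    using inv small
  proof eventually_elim
    case (elim t)
    have "c t - c0 = c t * (g0 - g t) * c0"
      using elim(1) inv0 by (simp add: algebra_simps)
    then have 1: "norm (c t - c0) \<le> norm (c t) * (?u t * norm c0)"
      using order_trans[OF norm_mult_ineq mult_left_mono[OF norm_mult_ineq norm_ge_zero],
          of "c t" "g0 - g t" c0] by (simp add: mult.assoc)
    also have "\<dots> \<le> norm (c t) * (1 / 2)" using elim(2) by (intro mult_left_mono) auto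
    finally have "norm (c t) \<le> 2 * norm c0" using norm_triangle_sub[of "c t" c0] by simp
    then have "norm (c t) * (?u t * norm c0) \<le> 2 * norm c0 * (?u t * norm c0)"
      by (rule mult_right_mono) simp
    then show ?case using 1 by linarith
  qed
  moreover have "((\<lambda>t. 2 * norm c0 * (?u t * norm c0)) \<longlongrightarrow> 0) F"
    using u by (intro tendsto_mult_right_zero tendsto_mult_left_zero)
  ultimately have "((\<lambda>t. c t - c0) \<longlongrightarrow> 0) F" by (rule Lim_null_comparison)
  then show ?thesis by (simp add: LIM_zero_iff)
qed

lemma bounded_inverses_on_path:
  fixes g c :: "real \<Rightarrow> 'a::real_normed_algebra_1"
  assumes g: "continuous_on {0..1} g"
    and inv: "\<And>t. t \<in> {0..1} \<Longrightarrow> g t * c t = 1" "\<And>t. t \<in> {0..1} \<Longrightarrow> c t * g t = 1"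
  obtains K where "K \<ge> 0" "\<And>t. t \<in> {0..1} \<Longrightarrow> norm (g t) \<le> K" "\<And>t. t \<in> {0..1} \<Longrightarrow> norm (c t) \<le> K"
proof -
  have c: "continuous_on {0..1} c"
    unfolding continuous_on_def
  proof
    fix t :: real assume t: "t \<in> {0..1}"
    show "(c \<longlongrightarrow> c t) (at t within {0..1})"
    proof (rule tendsto_one_sided_inverse)
      show "(g \<longlongrightarrow> g t) (at t within {0..1})" using g t by (simp add: continuous_on_def)
      show "\<forall>\<^sub>F s in at t within {0..1}. c s * g s = 1"
        using inv(2) by (auto simp: eventually_at_filter)
    qed (rule inv(1)[OF t])
  qed
  obtain K1 where K1: "\<forall>t\<in>{0..1}. norm (g t) \<le> K1"
    using compact_imp_bounded[OF compact_continuous_image[OF g compact_Icc]] by (auto simp: bounded_iff)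
  obtain K2 where K2: "\<forall>t\<in>{0..1}. norm (c t) \<le> K2"
    using compact_imp_bounded[OF compact_continuous_image[OF c compact_Icc]] by (auto simp: bounded_iff)
  show thesis
    by (rule that[of "max 0 (max K1 K2)"]) (use K1 K2 in \<open>auto simp: le_max_iff_disj\<close>)
qed

text \<open>
  One Euler step, with its remainder: \<open>c\<close> and \<open>c'\<close> are the inverses of \<open>g\<close> and \<open>g'\<close>, the commutator
  with \<open>h\<close> is the first-order term, and the last summand is quadratic in \<open>h\<close>.
\<close>
lemma similarity_step:
  fixes x :: "'a::ring_1"
  assumes "g * c = 1" "c' * g' = 1"
  defines "h \<equiv> c * (g' - g)" and "y \<equiv> c * x * g"
  assumes "c * g = 1"
  shows "c' * x * g' = y + (y * h - h * y) - c' * g * h * (y * h - h * y)"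
proof -
  let ?R = "c' * g"
  have r: "c * g' = 1 + h" using assms by (simp add: h_def algebra_simps)
  have "?R * (c * g') = c' * (g * c) * g'" by (simp only: mult.assoc)
  then have "?R * (1 + h) = 1" using assms by (simp add: r)
  then have R: "?R = 1 - ?R * h" by (simp add: algebra_simps)
  have "c' * x * g' = c' * (g * c) * x * (g * c) * g'" using assms by simp
  also have "\<dots> = ?R * y * (1 + h)" by (simp only: y_def mult.assoc flip: r)
  also have "\<dots> = ?R * (1 + h) * y + ?R * (y * h - h * y)"
    by (simp add: distrib_left distrib_right right_diff_distrib mult.assoc)
  also have "\<dots> = y + ?R * (y * h - h * y)" by (simp add: \<open>?R * (1 + h) = 1\<close>)
  also have "\<dots> = y + (1 - ?R * h) * (y * h - h * y)" using R by simp
  finally show ?thesis by (simp add: left_diff_distrib)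
qed

lemma norm_commutator_le:
  fixes y h :: "'a::real_normed_algebra"
  assumes "norm h \<le> \<kappa>"
  shows "norm (y * h - h * y) \<le> 2 * \<kappa> * norm y"
proof -
  have "norm (y * h - h * y) \<le> norm (y * h) + norm (h * y)" by (rule norm_triangle_ineq4)
  also have "\<dots> \<le> norm y * norm h + norm h * norm y" by (intro add_mono norm_mult_ineq)
  also have "\<dots> = 2 * norm h * norm y" by simp
  also have "\<dots> \<le> 2 * \<kappa> * norm y" using assms by (intro mult_right_mono) auto
  finally show ?thesis .
qed

text \<open>
  Compare \<open>y i = c(i/M) * x * g(i/M)\<close> with the Euler polygon \<open>l\<close> that starts in \<open>x\<close> and is driven by the
  commutators with \<open>h i\<close>. The polygon stays in \<open>L\<close> by the Lie property. As \<open>h i\<close> is of order \<open>1/M\<close>,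
  each step adds an error of order \<open>1/M\<^sup>2\<close> and amplifies earlier ones by a factor
  \<open>1 + O(1/M)\<close>, so after \<open>M\<close> steps the error is of order \<open>1/M\<close>, and \<open>L\<close> is closed.
\<close>
lemma lie_similarity_along_path:
  fixes A L :: "'a::cstar_algebra set" and g c :: "real \<Rightarrow> 'a"
  assumes A: "subalgebra A" and L: "lie_subspace_over A L" "closed L"
    and g: "\<And>t. t \<in> {0..1} \<Longrightarrow> g t \<in> A" and c: "\<And>t. t \<in> {0..1} \<Longrightarrow> c t \<in> A"
    and inv: "\<And>t. t \<in> {0..1} \<Longrightarrow> g t * c t = 1" "\<And>t. t \<in> {0..1} \<Longrightarrow> c t * g t = 1"
    and lip: "\<And>s t. s \<in> {0..1} \<Longrightarrow> t \<in> {0..1} \<Longrightarrow> norm (g s - g t) \<le> C * \<bar>s - t\<bar>"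
    and g0: "g 0 = 1" and x: "x \<in> L"
  shows "c 1 * x * g 1 \<in> L"
proof -
  have C: "C \<ge> 0" using order_trans[OF norm_ge_zero lip[of 0 1]] by simp
  have "continuous_on {0..1} g"
    by (rule lipschitz_on_continuous_on[of C]) (auto simp: lipschitz_on_def dist_norm C lip)
  then obtain K where K: "K \<ge> 0" "\<And>t. t \<in> {0..1} \<Longrightarrow> norm (g t) \<le> K" "\<And>t. t \<in> {0..1} \<Longrightarrow> norm (c t) \<le> K"
    using bounded_inverses_on_path inv by blast
  define \<kappa> where "\<kappa> = K * C"
  \<comment> \<open>\<open>\<kappa> / M\<close> bounds \<open>h i\<close>, and \<open>Q / M\<^sup>2\<close> bounds the remainder in \<open>similarity_step\<close>\<close>
  define Q where "Q = (K * K) * \<kappa> * (2 * \<kappa> * (K * norm x * K))"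
  have \<kappa>Q: "\<kappa> \<ge> 0" "Q \<ge> 0" using K C by (simp_all add: \<kappa>_def Q_def)
  have sub: "complex_vector.subspace L" using L by (simp add: lie_subspace_over_def)
  have approx: "\<exists>l\<in>L. norm (l - c 1 * x * g 1) \<le> Q * exp (2 * \<kappa>) / M" if M: "M > 0" for M :: nat
  proof -
    define \<tau> where "\<tau> i = real i / M" for i
    have \<tau>: "\<tau> i \<in> {0..1}" if "i \<le> M" for i using that M by (simp add: \<tau>_def)
    define h where "h i = c (\<tau> i) * (g (\<tau> (Suc i)) - g (\<tau> i))" for i
    define y where "y i = c (\<tau> i) * x * g (\<tau> i)" for i
    define l where "l = rec_nat x (\<lambda>i z. z + (z * h i - h i * z))"
    have l0: "l 0 = x" and lS: "l (Suc i) = l i + (l i * h i - h i * l i)" for i by (simp_all add: l_def)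
    have hA: "h i \<in> A" if "i < M" for i
      unfolding h_def using that
      by (intro subalgebraD(2)[OF A] complex_vector.subspace_diff[OF subalgebraD(1)[OF A]] g c \<tau>) auto
    have hn: "norm (h i) \<le> \<kappa> / M" if i: "i < M" for i
    proof -
      have "norm (h i) \<le> norm (c (\<tau> i)) * norm (g (\<tau> (Suc i)) - g (\<tau> i))"
        unfolding h_def by (rule norm_mult_ineq)
      also have "\<dots> \<le> K * (C * \<bar>\<tau> (Suc i) - \<tau> i\<bar>)"
        using i K \<tau> by (intro mult_mono lip) auto
      also have "\<dots> = \<kappa> / M" using M by (simp add: \<tau>_def \<kappa>_def flip: diff_divide_distrib)
      finally show ?thesis .
    qed
    have lL: "l i \<in> L" if "i \<le> M" for i
      using that
    proof (induction i)
      case (Suc i)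
      then have "h i * l i - l i * h i \<in> L" using L(1) hA by (simp add: lie_subspace_over_def)
      moreover have "l i \<in> L" using Suc by simp
      ultimately have "l i - (h i * l i - l i * h i) \<in> L"
        using complex_vector.subspace_diff[OF sub] by blast
      then show ?case by (simp add: lS algebra_simps)
    qed (simp add: l0 x)
    have err: "norm (y i - l i) \<le> i * (Q / M / M) * (1 + 2 * (\<kappa> / M)) ^ i" if "i \<le> M" for i
      using that
    proof (induction i)
      case 0
      have "c 0 = 1" using inv(1)[of 0] g0 by simp
      then show ?case by (simp add: y_def \<tau>_def l0 g0)
    next
      case (Suc i)
      have t: "\<tau> i \<in> {0..1}" "\<tau> (Suc i) \<in> {0..1}" using Suc.prems \<tau> by auto
      let ?R = "c (\<tau> (Suc i)) * g (\<tau> i)" and ?D = "y i - l i" and ?q = "1 + 2 * (\<kappa> / M)"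
      have q: "?q \<ge> 1" using \<kappa>Q by simp
      have hi: "norm (h i) \<le> \<kappa> / M" using hn Suc.prems by simp
      have step: "y (Suc i) = y i + (y i * h i - h i * y i) - ?R * h i * (y i * h i - h i * y i)"
        unfolding y_def h_def using t by (intro similarity_step inv)
      have diff: "y (Suc i) - l (Suc i) = ?D + (?D * h i - h i * ?D) - ?R * h i * (y i * h i - h i * y i)"
        unfolding step lS by (simp add: left_diff_distrib right_diff_distrib)
      have "norm (y (Suc i) - l (Suc i)) \<le>
          norm ?D + norm (?D * h i - h i * ?D) + norm (?R * h i * (y i * h i - h i * y i))"
        unfolding diff by (rule order_trans[OF norm_triangle_ineq4]) (intro add_mono norm_triangle_ineq order_refl)
      also have "\<dots> \<le> norm ?D + 2 * (\<kappa> / M) * norm ?D + Q / M / M"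
      proof (rule add_mono[OF add_mono[OF order_refl norm_commutator_le[OF hi]]])
        have "norm (y i) \<le> norm (c (\<tau> i)) * norm x * norm (g (\<tau> i))"
          unfolding y_def by (rule order_trans[OF norm_mult_ineq]) (intro mult_right_mono norm_mult_ineq norm_ge_zero)
        also have "\<dots> \<le> K * norm x * K" using t K by (intro mult_mono) auto
        finally have yn: "norm (y i) \<le> K * norm x * K" .
        have "norm (?R * h i * (y i * h i - h i * y i)) \<le> norm (?R * h i) * norm (y i * h i - h i * y i)"
          by (rule norm_mult_ineq)
        also have "\<dots> \<le> (K * K) * (\<kappa> / M) * (2 * (\<kappa> / M) * (K * norm x * K))"
        proof (rule mult_mono)
          have "norm ?R \<le> K * K" using t K by (intro order_trans[OF norm_mult_ineq] mult_mono) auto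
          then show "norm (?R * h i) \<le> (K * K) * (\<kappa> / M)"
            using mult_mono[OF _ hi, of "norm ?R" "K * K"] K
            by (intro order_trans[OF norm_mult_ineq]) auto
          have "2 * (\<kappa> / M) * norm (y i) \<le> 2 * (\<kappa> / M) * (K * norm x * K)"
            using yn \<kappa>Q by (intro mult_left_mono) auto
          then show "norm (y i * h i - h i * y i) \<le> 2 * (\<kappa> / M) * (K * norm x * K)"
            using norm_commutator_le[OF hi, of "y i"] by simp
        qed (use K \<kappa>Q in auto)
        also have "\<dots> = Q / M / M" by (simp add: Q_def)
        finally show "norm (?R * h i * (y i * h i - h i * y i)) \<le> Q / M / M" .
      qed
      also have "\<dots> = ?q * norm ?D + Q / M / M" by (simp add: distrib_right)
      also have "\<dots> \<le> ?q * (i * (Q / M / M) * ?q ^ i) + Q / M / M * ?q ^ Suc i"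
      proof (rule add_mono)
        show "?q * norm ?D \<le> ?q * (i * (Q / M / M) * ?q ^ i)"
          using Suc q by (intro mult_left_mono) auto
        show "Q / M / M \<le> Q / M / M * ?q ^ Suc i"
          using mult_left_mono[OF one_le_power[OF q, of "Suc i"], of "Q / M / M"] \<kappa>Q by simp
      qed
      also have "\<dots> = Suc i * (Q / M / M) * ?q ^ Suc i"
      proof -
        have "b * (i * w * b ^ i) + w * b ^ Suc i = Suc i * w * b ^ Suc i" for b w :: real
          by (simp add: algebra_simps)
        then show ?thesis .
      qed
      finally show ?case .
    qed
    have "(1 + 2 * (\<kappa> / M)) ^ M \<le> exp (2 * (\<kappa> / M)) ^ M"
      using \<kappa>Q by (intro power_mono exp_ge_add_one_self) auto
    also have "\<dots> = exp (2 * \<kappa>)" using M by (simp flip: exp_of_nat_mult)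
    finally have "Q / M * (1 + 2 * (\<kappa> / M)) ^ M \<le> Q / M * exp (2 * \<kappa>)"
      using \<kappa>Q by (intro mult_left_mono) auto
    then have "norm (l M - y M) \<le> Q * exp (2 * \<kappa>) / M"
      using err[of M] M by (simp add: norm_minus_commute)
    moreover have "y M = c 1 * x * g 1" using M by (simp add: y_def \<tau>_def)
    ultimately show ?thesis using lL by auto
  qed
  have "\<exists>l\<in>L. dist l (c 1 * x * g 1) < \<epsilon>" if \<epsilon>: "\<epsilon> > 0" for \<epsilon>
  proof -
    obtain M :: nat where M: "Q * exp (2 * \<kappa>) / \<epsilon> < M" using reals_Archimedean2 by blast
    have "0 \<le> Q * exp (2 * \<kappa>) / \<epsilon>" using \<kappa>Q \<epsilon> by simp
    then have M0: "M > 0" using M by (simp flip: of_nat_0_less_iff)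
    then have "Q * exp (2 * \<kappa>) / M < \<epsilon>" using M \<epsilon> by (simp add: field_simps)
    then show ?thesis using approx[OF M0] by (force simp: dist_norm)
  qed
  then have "c 1 * x * g 1 \<in> closure L" by (simp add: closure_approachable)
  then show ?thesis using L(2) by simp
qed

section \<open>Invertible elements of finite-dimensional subalgebras\<close>

text \<open>
  The first \<open>dim S + 1\<close> powers of \<open>a\<close> are linearly dependent, or two of them coincide.
\<close>
lemma annihilating_polynomial:
  fixes a :: "'a::cstar_algebra"
  assumes S: "finite_dimensional S" "\<And>n. a ^ n \<in> S"
  obtains f :: "nat \<Rightarrow> complex" and m where "\<exists>i\<le>m. f i \<noteq> 0" "(\<Sum>i\<le>m. f i *\<^sub>C a ^ i) = 0"
proof -
  obtain F where F: "finite F" "S = complex_vector.span F" using S(1) by (auto simp: finite_dimensional_def)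
  let ?m = "card F"
  show thesis
  proof (cases "inj_on (\<lambda>i. a ^ i) {..?m}")
    case True
    let ?P = "(\<lambda>i. a ^ i) ` {..?m}"
    have "card ?P = Suc ?m" using True by (simp add: card_image)
    then have "complex_vector.dependent ?P"
      using complex_vector.independent_span_bound[OF F(1), of ?P] S(2) F(2) by auto
    then obtain u where u: "\<exists>v\<in>?P. u v \<noteq> 0" "(\<Sum>v\<in>?P. u v *\<^sub>C v) = 0"
      by (subst (asm) complex_vector.dependent_finite) auto
    show thesis
      by (rule that[of ?m "\<lambda>i. u (a ^ i)"]) (use u True in \<open>auto simp: sum.reindex\<close>)
  next
    case False
    then obtain i j where ij: "i < j" "a ^ i = a ^ j"
      unfolding inj_on_def by (metis linorder_neqE_nat)
    let ?f = "\<lambda>k. if k = i then 1 else if k = j then -1 else (0::complex)"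
    have "(\<Sum>k\<le>j. ?f k *\<^sub>C a ^ k) = (\<Sum>k\<le>j. (if k = i then a ^ i else 0) - (if k = j then a ^ j else 0))"
      using ij by (intro sum.cong refl) (auto simp: scaleC_one)
    also have "\<dots> = a ^ i - a ^ j" using ij by (simp add: sum_subtractf)
    finally have "(\<Sum>k\<le>j. ?f k *\<^sub>C a ^ k) = 0" using ij by simp
    then show thesis using ij by (intro that[of j ?f]) auto
  qed
qed

text \<open>
  Let \<open>f\<close> be an annihilating polynomial. Since \<open>a - z\<close> divides \<open>a\<^sup>n - z\<^sup>n\<close> for every \<open>n\<close>, it divides
  \<open>f(a) - f(z) = - f(z)\<close>, with a polynomial in \<open>a\<close> as cofactor. So it is invertible, with
  inverse in \<open>A\<close>, unless \<open>z\<close> is one of the finitely many roots of \<open>f\<close>.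
\<close>
lemma finite_spectrum:
  fixes a :: "'a::cstar_algebra"
  assumes S: "finite_dimensional S" "\<And>n. a ^ n \<in> S" and A: "subalgebra A" "1 \<in> A" "a \<in> A"
  obtains Z where "finite Z"
    "\<And>z. z \<notin> Z \<Longrightarrow> \<exists>b\<in>A. (a - z *\<^sub>C 1) * b = 1 \<and> b * (a - z *\<^sub>C 1) = 1"
proof -
  obtain f m where f: "\<exists>i\<le>m. f i \<noteq> 0" "(\<Sum>i\<le>m. f i *\<^sub>C a ^ i) = 0"
    using annihilating_polynomial[OF S] by blast
  let ?Z = "{z. (\<Sum>i\<le>m. f i * z ^ i) = 0}"
  have sub: "complex_vector.subspace A" using A(1) by (rule subalgebraD)
  have "\<exists>b\<in>A. (a - z *\<^sub>C 1) * b = 1 \<and> b * (a - z *\<^sub>C 1) = 1" if z: "z \<notin> ?Z" for z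
  proof -
    let ?d = "a - z *\<^sub>C 1" and ?w = "\<Sum>i\<le>m. f i * z ^ i"
    have "\<exists>b\<in>A. ?d * b = a ^ n - z ^ n *\<^sub>C 1 \<and> b * ?d = a ^ n - z ^ n *\<^sub>C 1" for n
    proof (induction n)
      case 0
      show ?case using complex_vector.subspace_0[OF sub] by (intro bexI[of _ 0]) (auto simp: scaleC_one)
    next
      case (Suc n)
      then obtain b where b: "b \<in> A" "?d * b = a ^ n - z ^ n *\<^sub>C 1" "b * ?d = a ^ n - z ^ n *\<^sub>C 1" by blast
      have "?d * (a * b + z ^ n *\<^sub>C 1) = a * (?d * b) + z ^ n *\<^sub>C ?d"
        by (simp add: algebra_simps mult_scaleC_left mult_scaleC_right)
      moreover have "(a * b + z ^ n *\<^sub>C 1) * ?d = a * (b * ?d) + z ^ n *\<^sub>C ?d"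
        by (simp add: algebra_simps mult_scaleC_left mult_scaleC_right)
      moreover have "a * (a ^ n - z ^ n *\<^sub>C 1) + z ^ n *\<^sub>C ?d = a ^ Suc n - z ^ Suc n *\<^sub>C 1"
        by (simp add: right_diff_distrib mult_scaleC_right complex_vector.scale_right_diff_distrib
            scaleC_scaleC mult.commute)
      moreover have "a * b + z ^ n *\<^sub>C 1 \<in> A"
        using A b(1) sub subalgebraD(2)[OF A(1)]
        by (intro complex_vector.subspace_add complex_vector.subspace_scale) auto
      ultimately show ?case using b(2,3) by auto
    qed
    then obtain b where b: "\<And>n. b n \<in> A" "\<And>n. ?d * b n = a ^ n - z ^ n *\<^sub>C 1"
        "\<And>n. b n * ?d = a ^ n - z ^ n *\<^sub>C 1"
      by metis
    let ?q = "\<Sum>i\<le>m. f i *\<^sub>C b i"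
    have val: "(\<Sum>i\<le>m. f i *\<^sub>C (a ^ i - z ^ i *\<^sub>C 1)) = - (?w *\<^sub>C 1)"
      by (simp add: complex_vector.scale_right_diff_distrib sum_subtractf f(2) scaleC_scaleC
          complex_vector.scale_sum_left)
    have "?d * ?q = - (?w *\<^sub>C 1)" "?q * ?d = - (?w *\<^sub>C 1)"
      by (simp_all add: sum_distrib_left sum_distrib_right mult_scaleC_left mult_scaleC_right b flip: val)
    moreover have "?q \<in> A" using b(1) sub
      by (intro complex_vector.subspace_sum complex_vector.subspace_scale) auto
    then have "(- inverse ?w) *\<^sub>C ?q \<in> A" by (rule complex_vector.subspace_scale[OF sub])
    ultimately show ?thesis
      using z by (intro bexI[of _ "(- inverse ?w) *\<^sub>C ?q"])
        (auto simp: mult_scaleC_left mult_scaleC_right scaleC_scaleC scaleC_one)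
  qed
  moreover have "finite ?Z" using f(1) by (simp add: polyfun_finite_roots)
  ultimately show thesis by (rule that[rotated])
qed

text \<open>
  Up to a positive factor, the points of the segment from \<open>1\<close> to \<open>a - \<i> y\<close>, other than \<open>1\<close> itself, are
  the elements \<open>a - z\<close> with \<open>z\<close> on the half-line from \<open>\<i> y\<close> to \<open>\<i> y - \<infinity>\<close>. A small \<open>y > 0\<close> that is not
  the imaginary part of an exceptional \<open>z\<close> makes all of them invertible in \<open>A\<close>.
\<close>
lemma lie_similarity_finite_dimensional:
  fixes A L :: "'a::cstar_algebra set"
  assumes A: "subalgebra A" "1 \<in> A" and L: "lie_subspace_over A L" "closed L" and x: "x \<in> L"
    and S: "finite_dimensional S" "\<And>n. a ^ n \<in> S" and a: "a \<in> A" and \<eta>: "\<eta> > 0"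
  shows "\<exists>g\<in>A. \<exists>c\<in>A. g * c = 1 \<and> c * g = 1 \<and> norm (a - g) < \<eta> \<and> c * x * g \<in> L"
proof -
  obtain Z where Z: "finite Z"
    "\<And>z. z \<notin> Z \<Longrightarrow> \<exists>b\<in>A. (a - z *\<^sub>C 1) * b = 1 \<and> b * (a - z *\<^sub>C 1) = 1"
    using finite_spectrum[OF S A a] by blast
  have "infinite ({0<..<\<eta>} - Im ` Z)" using Z(1) \<eta> by (simp add: Diff_infinite_finite)
  then obtain y where y: "0 < y" "y < \<eta>" "y \<notin> Im ` Z"
    by (metis Diff_iff finite.emptyI equals0I greaterThanLessThan_iff)
  define g where "g t = t *\<^sub>R (a - (\<i> * y) *\<^sub>C 1) + (1 - t) *\<^sub>R 1" for t :: real
  have sub: "complex_vector.subspace A" using A(1) by (rule subalgebraD)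
  have gA: "g t \<in> A" for t
    unfolding g_def using a A sub
    by (intro complex_vector.subspace_add complex_vector.subspace_diff subspace_scaleR
        complex_vector.subspace_scale)
  have "\<exists>c\<in>A. g t * c = 1 \<and> c * g t = 1" if t: "t \<in> {0..1}" for t
  proof (cases "t = 0")
    case True
    then show ?thesis using A(2) by (intro bexI[of _ 1]) (simp_all add: g_def)
  next
    case False
    define z where "z = \<i> * y - complex_of_real ((1 - t) / t)"
    have "Im z = y" by (simp add: z_def)
    then have "z \<notin> Z" using y(3) by auto
    then obtain b where b: "b \<in> A" "(a - z *\<^sub>C 1) * b = 1" "b * (a - z *\<^sub>C 1) = 1" using Z(2) by blast
    have "z *\<^sub>C (1::'a) = (\<i> * y) *\<^sub>C 1 - ((1 - t) / t) *\<^sub>R 1"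
      by (simp only: z_def complex_vector.scale_left_diff_distrib scaleR_scaleC)
    moreover have "t *\<^sub>R (v - (w - ((1 - t) / t) *\<^sub>R 1)) = t *\<^sub>R (v - w) + (1 - t) *\<^sub>R (1::'a)" for v w
      using False by (simp add: scaleR_diff_right)
    ultimately have "t *\<^sub>R (a - z *\<^sub>C 1) = g t" by (simp only: g_def)
    then have "g t * (inverse t *\<^sub>R b) = 1" "inverse t *\<^sub>R b * g t = 1"
      using b(2,3) False by (simp_all flip: \<open>t *\<^sub>R (a - z *\<^sub>C 1) = g t\<close>)
    then show ?thesis using b(1) subspace_scaleR[OF sub] by blast
  qed
  then obtain c where c: "\<And>t. t \<in> {0..1} \<Longrightarrow> c t \<in> A" "\<And>t. t \<in> {0..1} \<Longrightarrow> g t * c t = 1"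
    "\<And>t. t \<in> {0..1} \<Longrightarrow> c t * g t = 1" by metis
  have "g s - g t = (s - t) *\<^sub>R (a - (\<i> * y) *\<^sub>C 1 - 1)" for s t
    by (simp add: g_def algebra_simps)
  then have "norm (g s - g t) \<le> norm (a - (\<i> * y) *\<^sub>C 1 - 1) * \<bar>s - t\<bar>" for s t
    by (simp add: mult.commute)
  then have "c 1 * x * g 1 \<in> L"
    using c gA by (intro lie_similarity_along_path[OF A(1) L, where g = g and c = c] x) (auto simp: g_def)
  moreover have "norm (a - g 1) < \<eta>" using y by (simp add: g_def norm_scaleC norm_mult)
  ultimately show ?thesis using gA c[of 1] by auto
qed

section \<open>Lie subspaces and similarity-invariant subspaces\<close>

theorem corollary1:
  fixes D A L :: "'a::cstar_algebra set"
  assumes "canonical_masa D"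
    and "canonical_subalgebra D A"
    and "complex_vector.subspace L"
    and "closed L"
  shows "lie_subspace_over A L \<longleftrightarrow> similarity_invariant A L"
proof -
  obtain B r d e where AF: "AF_sequence B" and units: "\<And>n. matrix_units (B n) (r n) (d n) (e n)"
    and refine: "\<And>n u. u \<in> matrix_unit_index (r n) (d n) \<Longrightarrow>
      \<exists>T\<subseteq>matrix_unit_index (r (Suc n)) (d (Suc n)). e n u = (\<Sum>v\<in>T. e (Suc n) v)"
    and D: "D = closure (\<Union>n. diagonal_span (r n) (d n) (e n))"
    using assms(1) unfolding canonical_masa_def by blast
  interpret matrix_unit_tower B r d e
    by unfold_locales (fact AF units refine)+
  have A: "subalgebra A" "closed A" "D \<subseteq> A" using assms(2) by (auto simp: canonical_subalgebra_def)
  have pA: "dproj m s \<in> A" if "s \<in> diag m" for m s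
  proof -
    have "dproj m s \<in> diagonal_span (r m) (d m) (e m)"
      unfolding diagonal_span_def using that
      by (intro complex_vector.span_base) (cases s, auto simp: dproj_def)
    then have "dproj m s \<in> D" unfolding D by (intro subsetD[OF closure_subset] UN_I[of m]) simp_all
    then show ?thesis using A(3) by (rule rev_subsetD)
  qed
  have one: "1 \<in> A"
    unfolding sum_dproj[of 0, symmetric] by (intro complex_vector.subspace_sum subalgebraD(1)[OF A(1)] pA)
  show ?thesis
  proof
    assume "similarity_invariant A L"
    then show "lie_subspace_over A L"
      using similarity_invariant_imp_lie[OF A(1) one A(2) assms(3,4)] by simp
  next
    assume lie: "lie_subspace_over A L"
    have "b * x * a \<in> L" if x: "x \<in> L" and ab: "a \<in> A" "b \<in> A" "a * b = 1" "b * a = 1" for x a b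
    proof -
      have "\<exists>g\<in>A. \<exists>c\<in>A. g * c = 1 \<and> c * g = 1 \<and> norm (a - g) < inverse (Suc n) \<and> c * x * g \<in> L" for n
      proof -
        let ?\<epsilon> = "inverse (real (Suc n)) / 2"
        obtain N a' where a': "a' \<in> A" "a' \<in> B N" "norm (a - a') < ?\<epsilon>"
          using closed_subalgebra_inductive[OF A(1,2) pA ab(1), of ?\<epsilon>] by auto
        have "finite_dimensional (B N)" using AF by (simp add: AF_sequence_def)
        then obtain g c where gc: "g \<in> A" "c \<in> A" "g * c = 1" "c * g = 1" "norm (a' - g) < ?\<epsilon>" "c * x * g \<in> L"
          using lie_similarity_finite_dimensional[OF A(1) one lie assms(4) x _ _ a'(1), of "B N" ?\<epsilon>]
            subalgebra_power[OF subalgebra_B one_in_B a'(2)] by auto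
        have "norm (a - g) < inverse (Suc n)"
          using norm_triangle_ineq[of "a - a'" "a' - g"] a'(3) gc(5) by simp
        then show ?thesis using gc by blast
      qed
      then obtain g c where gc: "\<And>n. g n * c n = 1" "\<And>n. c n * g n = 1"
          "\<And>n. norm (a - g n) < inverse (Suc n)" "\<And>n. c n * x * g n \<in> L"
        by metis
      have "(\<lambda>n. a - g n) \<longlonglongrightarrow> 0"
        by (rule Lim_null_comparison[OF _ LIMSEQ_inverse_real_of_nat])
          (intro always_eventually allI less_imp_le gc(3))
      then have g: "g \<longlonglongrightarrow> a" using tendsto_diff[OF tendsto_const[of a], of "\<lambda>n. a - g n" 0] by simp
      have "c \<longlonglongrightarrow> b" by (rule tendsto_one_sided_inverse[OF g]) (simp_all add: gc ab)
      then have "(\<lambda>n. c n * x * g n) \<longlonglongrightarrow> b * x * a" using g by (intro tendsto_mult tendsto_const)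
      then show ?thesis using assms(4) gc(4) by (rule closed_sequentially[rotated -1])
    qed
    then show "similarity_invariant A L" by (auto simp: similarity_invariant_def)
  qed
qed

end
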